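(* If $M \in \mathbf{M}_3(\mathbb{C})$ is complex symmetric, then $M$ is unitarily equivalent to a direct sum of truncated Toeplitz operators.
   Context: $\mathbf{M}_3(\mathbb{C})$ is the set of $3\times 3$ complex matrices, acting on $\mathbb{C}^3$ with its standard inner product. A matrix $M$ is complex symmetric if $M=M^t$, where $M^t$ is the transpose (no conjugation). $\mathbb{D}$ is the open unit disk, $H^2$ the Hardy space on $\mathbb{D}$ (regarded via boundary values as a closed subspace of $L^2=L^2(\partial\mathbb{D})$). For a nonconstant inner function $\Theta$, the model space is $\mathcal{K}_\Theta := H^2 \ominus \Theta H^2$, with the inner product inherited from $L^2$, and $P_\Theta$ is the orthogonal projection of $L^2$ onto $\mathcal{K}_\Theta$. For a symbol $\varphi\in L^2$, the truncated Toeplitz operator $A_\varphi^\Theta$ is the densely defined operator on $\mathcal{K}_\Theta$ given by $A_\varphi^\Theta f := P_\Theta(\varphi f)$; when $\mathcal{K}_\Theta$ is finite-dimensional (i.e. $\Theta$ is a finite Blaschke product) its elements are bounded functions and $A_\varphi^\Theta$ is defined on all of $\mathcal{K}_\Theta$. A direct sum of truncated Toeplitz operators is an orthogonal direct sum $A_{\varphi_1}^{\Theta_1}\oplus\cdots\oplus A_{\varphi_m}^{\Theta_m}$ ($m\ge 1$) acting on $\mathcal{K}_{\Theta_1}\oplus\cdots\oplus\mathcal{K}_{\Theta_m}$; the $\Theta_k$ and $\varphi_k$ may vary with the summand. Operators $S$ and $T$ on Hilbert spaces $\mathcal{X}$ and $\mathcal{Y}$ are unitarily equivalent if $US=TU$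 for some unitary $U:\mathcal{X}\to\mathcal{Y}$. *)

theory Defs
  imports "HOL-Analysis.Analysis"
begin

text \<open>Normalized arc length on the unit circle. The underlying space is the circle itself and
  not the plane, so that measurability of a function on \<^typ>\<open>complex\<close> with respect to this
  measure does not depend on its values off the circle.\<close>

definition circle_measure :: "complex measure" where
  "circle_measure =
    distr (uniform_measure lborel {0..2 * pi}) (restrict_space borel (sphere 0 1)) cis"

definition square_integrable :: "(complex \<Rightarrow> complex) \<Rightarrow> bool" where
  "square_integrable f \<longleftrightarrow>
    f \<in> borel_measurable circle_measure \<and> integrable circle_measure (\<lambda>z. (cmod (f z))\<^sup>2)"

lemma square_integrable_zero: "square_integrable (\<lambda>_. 0)"
  by (simp add: square_integrable_def)

lemma square_integrable_add:
  assumes "square_integrable f" "square_integrable g"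
  shows "square_integrable (\<lambda>z. f z + g z)"
proof -
  have [measurable]: "f \<in> borel_measurable circle_measure" "g \<in> borel_measurable circle_measure"
    using assms by (auto simp: square_integrable_def)
  have "integrable circle_measure (\<lambda>z. 2 * (cmod (f z))\<^sup>2 + 2 * (cmod (g z))\<^sup>2)"
    using assms by (auto simp: square_integrable_def)
  then have "integrable circle_measure (\<lambda>z. (cmod (f z + g z))\<^sup>2)"
  proof (rule Bochner_Integration.integrable_bound)
    have "(cmod (a + b))\<^sup>2 \<le> 2 * (cmod a)\<^sup>2 + 2 * (cmod b)\<^sup>2" for a b
    proof -
      have "(cmod (a + b))\<^sup>2 \<le> (cmod a + cmod b)\<^sup>2"
        by (intro power_mono norm_triangle_ineq norm_ge_zero)
      also have "\<dots> \<le> 2 * (cmod a)\<^sup>2 + 2 * (cmod b)\<^sup>2"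
        using sum_squares_bound[of "cmod a" "cmod b"] by (simp add: power2_sum)
      finally show ?thesis .
    qed
    then show "AE z in circle_measure.
        norm ((cmod (f z + g z))\<^sup>2) \<le> norm (2 * (cmod (f z))\<^sup>2 + 2 * (cmod (g z))\<^sup>2)"
      by simp
  qed measurable
  then show ?thesis by (simp add: square_integrable_def)
qed

lemma square_integrable_mult_const:
  assumes "square_integrable f"
  shows "square_integrable (\<lambda>z. c * f z)"
  using assms by (auto simp: square_integrable_def norm_mult power_mult_distrib)

lemma square_integrable_uminus:
  assumes "square_integrable f"
  shows "square_integrable (\<lambda>z. - f z)"
  using square_integrable_mult_const[OF assms, of "-1"] by simp

lemma square_integrable_diff:
  assumes "square_integrable f" "square_integrable g"
  shows "square_integrable (\<lambda>z. f z - g z)"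
  using square_integrable_add[OF assms(1) square_integrable_uminus[OF assms(2)]] by simp

text \<open>The space \<open>L\<^sup>2\<close> of the circle: square integrable functions modulo equality almost
  everywhere.\<close>

quotient_type ltwo = "complex \<Rightarrow> complex" / partial:
  "\<lambda>f g. square_integrable f \<and> square_integrable g \<and> (AE z in circle_measure. f z = g z)"
proof (rule part_equivpI)
  show "\<exists>f. square_integrable f \<and> square_integrable f \<and> (AE z in circle_measure. f z = f z)"
    by (rule exI[of _ "\<lambda>_. 0"]) (simp add: square_integrable_zero)
  show "symp (\<lambda>f g. square_integrable f \<and> square_integrable g \<and> (AE z in circle_measure. f z = g z))"
    by (simp add: symp_def eq_commute)
  show "transp (\<lambda>f g. square_integrable f \<and> square_integrable g \<and> (AE z in circle_measure. f z = g z))"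
    by (auto simp: transp_def)
qed

instantiation ltwo :: ab_group_add
begin

lift_definition zero_ltwo :: ltwo is "\<lambda>_. 0"
  by (simp add: square_integrable_zero)

lift_definition plus_ltwo :: "ltwo \<Rightarrow> ltwo \<Rightarrow> ltwo" is "\<lambda>f g z. f z + g z"
  by (elim conjE, intro conjI square_integrable_add; (assumption | (erule (1) eventually_elim2, simp)))

lift_definition minus_ltwo :: "ltwo \<Rightarrow> ltwo \<Rightarrow> ltwo" is "\<lambda>f g z. f z - g z"
  by (elim conjE, intro conjI square_integrable_diff; (assumption | (erule (1) eventually_elim2, simp)))

lift_definition uminus_ltwo :: "ltwo \<Rightarrow> ltwo" is "\<lambda>f z. - f z"
  by (elim conjE, intro conjI square_integrable_uminus; (assumption | (erule eventually_mono, simp)))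

instance
  by (standard; transfer; simp add: algebra_simps square_integrable_zero
      square_integrable_add square_integrable_diff square_integrable_uminus)

end

lift_definition ltwo_scale :: "complex \<Rightarrow> ltwo \<Rightarrow> ltwo" is "\<lambda>c f z. c * f z"
  by (elim conjE, intro conjI square_integrable_mult_const; (assumption | (erule eventually_mono, simp)))

lift_definition ltwo_inner :: "ltwo \<Rightarrow> ltwo \<Rightarrow> complex" is
  "\<lambda>f g. \<integral>z. f z * cnj (g z) \<partial>circle_measure"
proof -
  fix f f' g g' :: "complex \<Rightarrow> complex"
  assume f: "square_integrable f \<and> square_integrable f' \<and> (AE z in circle_measure. f z = f' z)"
    and g: "square_integrable g \<and> square_integrable g' \<and> (AE z in circle_measure. g z = g' z)"
  then have [measurable]:
      "f \<in> borel_measurable circle_measure" "f' \<in> borel_measurable circle_measure"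
      "g \<in> borel_measurable circle_measure" "g' \<in> borel_measurable circle_measure"
    by (auto simp: square_integrable_def)
  have "AE z in circle_measure. f z = f' z" "AE z in circle_measure. g z = g' z"
    using f g by auto
  then have "AE z in circle_measure. f z * cnj (g z) = f' z * cnj (g' z)"
    by eventually_elim simp
  moreover have "cnj \<in> borel_measurable borel"
    by (intro borel_measurable_continuous_onI continuous_intros)
  then have [measurable]: "(\<lambda>z. cnj (g z)) \<in> borel_measurable circle_measure"
      "(\<lambda>z. cnj (g' z)) \<in> borel_measurable circle_measure"
    by (auto intro: measurable_compose[rotated])
  ultimately show "(\<integral>z. f z * cnj (g z) \<partial>circle_measure) = (\<integral>z. f' z * cnj (g' z) \<partial>circle_measure)"
    by (intro integral_cong_AE) measurable
qed

text \<open>A function on the disk is regarded as an element of \<^typ>\<open>ltwo\<close> through its radial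
  limits, which exist almost everywhere for functions in the Hardy space by Fatou's theorem.\<close>

lift_definition has_boundary_values :: "(complex \<Rightarrow> complex) \<Rightarrow> ltwo \<Rightarrow> bool" is
  "\<lambda>F f. AE z in circle_measure. ((\<lambda>r. F (of_real r * z)) \<longlongrightarrow> f z) (at_left 1)"
proof -
  fix F f g :: "complex \<Rightarrow> complex"
  assume "square_integrable f \<and> square_integrable g \<and> (AE z in circle_measure. f z = g z)"
  then have "AE z in circle_measure.
      (((\<lambda>r. F (of_real r * z)) \<longlongrightarrow> f z) (at_left 1)) = (((\<lambda>r. F (of_real r * z)) \<longlongrightarrow> g z) (at_left 1))"
    by (auto elim: eventually_mono)
  then show "(AE z in circle_measure. ((\<lambda>r. F (of_real r * z)) \<longlongrightarrow> f z) (at_left 1)) =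
      (AE z in circle_measure. ((\<lambda>r. F (of_real r * z)) \<longlongrightarrow> g z) (at_left 1))"
    by (rule eventually_subst)
qed

definition hardy_functions :: "(complex \<Rightarrow> complex) set" where
  "hardy_functions = {F. F holomorphic_on ball 0 1 \<and>
    bdd_above ((\<lambda>r. \<integral>z. (cmod (F (of_real r * z)))\<^sup>2 \<partial>circle_measure) ` {0..<1})}"

definition hardy_space :: "ltwo set" where
  "hardy_space = {f. \<exists>F\<in>hardy_functions. has_boundary_values F f}"

definition inner_function :: "(complex \<Rightarrow> complex) \<Rightarrow> bool" where
  "inner_function \<Theta> \<longleftrightarrow> \<Theta> holomorphic_on ball 0 1 \<and> bounded (\<Theta> ` ball 0 1) \<and>
    (AE z in circle_measure. \<exists>w. cmod w = 1 \<and> ((\<lambda>r. \<Theta> (of_real r * z)) \<longlongrightarrow> w) (at_left 1))"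

text \<open>The subspace \<open>\<Theta> H\<^sup>2\<close>: the products are formed in the disk and then identified
  with their boundary values.\<close>

definition inner_multiples :: "(complex \<Rightarrow> complex) \<Rightarrow> ltwo set" where
  "inner_multiples \<Theta> = {g. \<exists>F\<in>hardy_functions. has_boundary_values (\<lambda>z. \<Theta> z * F z) g}"

definition model_space :: "(complex \<Rightarrow> complex) \<Rightarrow> ltwo set" where
  "model_space \<Theta> = {f \<in> hardy_space. \<forall>g\<in>inner_multiples \<Theta>. ltwo_inner f g = 0}"

definition ltwo_projection :: "ltwo set \<Rightarrow> ltwo \<Rightarrow> ltwo" where
  "ltwo_projection K g = (THE f. f \<in> K \<and> (\<forall>h\<in>K. ltwo_inner (g - f) h = 0))"

text \<open>An operator, possibly not everywhere defined, is a partial function; its domain is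
  its \<^const>\<open>dom\<close>. A truncated Toeplitz operator is taken on its maximal domain, the set of all
  \<open>f\<close> in the model space for which \<open>\<phi> f\<close> is again square integrable. This is the whole model
  space if the latter is finite-dimensional.\<close>

definition truncated_toeplitz :: "(complex \<Rightarrow> complex) \<Rightarrow> ltwo \<Rightarrow> ltwo \<rightharpoonup> ltwo" where
  "truncated_toeplitz \<Theta> \<phi> f =
    (let h = (\<lambda>z. rep_ltwo \<phi> z * rep_ltwo f z) in
     if f \<in> model_space \<Theta> \<and> square_integrable h
     then Some (ltwo_projection (model_space \<Theta>) (abs_ltwo h))
     else None)"

text \<open>The data of a complex inner product space whose vectors form a subset of a type.\<close>

record 'a inner_space =
  vectors :: "'a set"
  vadd :: "'a \<Rightarrow> 'a \<Rightarrow> 'a"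
  vscale :: "complex \<Rightarrow> 'a \<Rightarrow> 'a"
  vinner :: "'a \<Rightarrow> 'a \<Rightarrow> complex"

definition standard_space :: "(complex ^ 'n) inner_space" where
  "standard_space = \<lparr>vectors = UNIV, vadd = (+), vscale = (*s),
    vinner = (\<lambda>x y. \<Sum>i\<in>UNIV. x $ i * cnj (y $ i))\<rparr>"

definition ltwo_subspace :: "ltwo set \<Rightarrow> ltwo inner_space" where
  "ltwo_subspace K = \<lparr>vectors = K, vadd = (+), vscale = ltwo_scale, vinner = ltwo_inner\<rparr>"

definition direct_sum :: "nat \<Rightarrow> (nat \<Rightarrow> 'a inner_space) \<Rightarrow> (nat \<Rightarrow> 'a) inner_space" where
  "direct_sum m H = \<lparr>vectors = (\<Pi>\<^sub>E k\<in>{..<m}. vectors (H k)),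
    vadd = (\<lambda>x y. \<lambda>k\<in>{..<m}. vadd (H k) (x k) (y k)),
    vscale = (\<lambda>c x. \<lambda>k\<in>{..<m}. vscale (H k) c (x k)),
    vinner = (\<lambda>x y. \<Sum>k<m. vinner (H k) (x k) (y k))\<rparr>"

definition direct_sum_operator :: "nat \<Rightarrow> (nat \<Rightarrow> 'a \<rightharpoonup> 'a) \<Rightarrow> (nat \<Rightarrow> 'a) \<rightharpoonup> (nat \<Rightarrow> 'a)" where
  "direct_sum_operator m T x =
    (if \<forall>k<m. x k \<in> dom (T k) then Some (\<lambda>k\<in>{..<m}. the (T k (x k))) else None)"

definition unitary_map :: "'a inner_space \<Rightarrow> 'b inner_space \<Rightarrow> ('a \<Rightarrow> 'b) \<Rightarrow> bool" where
  "unitary_map X Y U \<longleftrightarrow> bij_betw U (vectors X) (vectors Y) \<and>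
    (\<forall>x\<in>vectors X. \<forall>y\<in>vectors X. U (vadd X x y) = vadd Y (U x) (U y)) \<and>
    (\<forall>c. \<forall>x\<in>vectors X. U (vscale X c x) = vscale Y c (U x)) \<and>
    (\<forall>x\<in>vectors X. \<forall>y\<in>vectors X. vinner Y (U x) (U y) = vinner X x y)"

text \<open>The equation \<open>U S = T U\<close> is one between partial functions and includes the equality
  of the domains.\<close>

definition unitarily_equivalent ::
  "'a inner_space \<Rightarrow> ('a \<rightharpoonup> 'a) \<Rightarrow> 'b inner_space \<Rightarrow> ('b \<rightharpoonup> 'b) \<Rightarrow> bool" where
  "unitarily_equivalent X S Y T \<longleftrightarrow>
    (\<exists>U. unitary_map X Y U \<and> (\<forall>x\<in>vectors X. map_option U (S x) = T (U x)))"

end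

theory Submission
  imports Defs "HOL-Complex_Analysis.Cauchy_Integral_Formula"
begin

text \<open>A single summand suffices. Write \<open>M = A + i B\<close> with \<open>A\<close>, \<open>B\<close> real symmetric. There is a
  nonsingular traceless real symmetric \<open>Q\<close> with \<open>tr (A Q) = tr (B Q) = 0\<close>; in an orthonormal
  eigenbasis of \<open>Q\<close>, ordered so that the first two eigenvalues have the same sign, \<open>M\<close> becomes a
  complex symmetric \<open>N\<close> with \<open>N 3 3 = p\<^sup>2 N 1 1 + q\<^sup>2 N 2 2\<close>, where \<open>p, q > 0\<close> and
  \<open>p\<^sup>2 + q\<^sup>2 = 1\<close>.

  For \<open>a = p\<^sup>2 - q\<^sup>2\<close> and \<open>\<Theta> = z (z\<^sup>2 - a) / (1 - a z\<^sup>2)\<close> the model space has the orthonormal basis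
  \<open>q (1 + z\<^sup>2) / (1 - a z\<^sup>2)\<close>, \<open>i p (1 - z\<^sup>2) / (1 - a z\<^sup>2)\<close>, \<open>2 p q z / (1 - a z\<^sup>2)\<close>. On the circle
  the products \<open>f i * cnj (f j)\<close> are \<open>1 / \<bar>1 - a z\<^sup>2\<bar>\<^sup>2\<close> times trigonometric polynomials of
  degree at most two, whose only linear relation apart from symmetry is
  \<open>\<bar>f 3\<bar>\<^sup>2 = p\<^sup>2 \<bar>f 1\<bar>\<^sup>2 + q\<^sup>2 \<bar>f 2\<bar>\<^sup>2\<close>. Hence \<open>N\<close> is the matrix of a truncated Toeplitz
  operator.\<close>

section \<open>Orthogonal frames for complex symmetric matrices\<close>

text \<open>A dimension count shapes the proof. Complex symmetric 3 by 3 matrices form a space of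
  dimension six, but the truncated Toeplitz operators on a model space of dimension n only one of
  dimension 2n - 1, here five. One linear condition has to be won by choosing the basis, and a real
  orthogonal change of basis is a unitary equivalence that keeps the matrix symmetric. In an
  eigenbasis of \<open>Q\<close> the trace of \<open>M ** Q\<close> is the sum of the diagonal
  entries of \<open>M\<close> weighted by the eigenvalues, so its vanishing is the desired
  condition, and \<open>trace Q = 0\<close> turns it into a weighted mean. A zero eigenvalue could
  give a weight 0, hence \<open>a\<close> equal to 1 or -1, where the inner function collapses to
  degree one. The delicate algebraic point is therefore that the determinant does not vanish
  identically under the trace conditions. On the analytic side a Hardy function and its boundary
  values are tied only by radial limits almost everywhere and bounded square means. Fourier
  coefficients have to be extracted from this before the model space can be computed.\<close>

lemma quadratic_growth_imp_zero:
  fixes c d :: real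
  assumes "\<And>e. 2 * e * c \<le> e\<^sup>2 * d"
  shows "c = 0"
proof (rule ccontr)
  assume "c \<noteq> 0"
  define n where "n = \<bar>d\<bar> + 1"
  have n: "n > 0" "d < n" by (auto simp: n_def)
  \<comment> \<open>For small \<open>e\<close> the linear term wins; \<open>e = c / n\<close> with
    \<open>n > d\<close> is small enough and has the sign of \<open>c\<close>.\<close>
  have "2 * (c / n) * c \<le> (c / n)\<^sup>2 * d" by (rule assms)
  then have "2 * c\<^sup>2 * n \<le> c\<^sup>2 * d"
    using n by (simp add: field_simps power2_eq_square)
  moreover have "c\<^sup>2 * d < c\<^sup>2 * n" "c\<^sup>2 * n > 0" using n \<open>c \<noteq> 0\<close> by simp_all
  ultimately show False by simp
qed

text \<open>The Rayleigh quotient attains its maximum on the compact unit sphere of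
  \<open>S\<close>, and the first-order condition at a maximizer makes it an eigenvector.\<close>

lemma selfadjoint_eigenvector:
  fixes f :: "'a::euclidean_space \<Rightarrow> 'a"
  assumes "linear f" and adj: "\<And>x y. f x \<bullet> y = x \<bullet> f y"
    and S: "subspace S" "S \<noteq> {0}" "f ` S \<subseteq> S"
  obtains v l where "v \<in> S" "norm v = 1" "f v = l *\<^sub>R v"
proof -
  interpret linear f by fact
  obtain u where u: "u \<in> S" "u \<noteq> 0" using S subspace_0 by blast
  have "compact (sphere 0 1 \<inter> S)"
    by (intro compact_Int_closed compact_sphere closed_subspace S)
  moreover have "u /\<^sub>R norm u \<in> sphere 0 1 \<inter> S" using u S by (auto simp: subspace_scale)
  moreover have "continuous_on (sphere 0 1 \<inter> S) (\<lambda>x. f x \<bullet> x)"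
    using linear_continuous_on[OF linear_conv_bounded_linear[THEN iffD1, OF assms(1)]]
    by (intro continuous_on_inner continuous_on_id)
  ultimately obtain v where v: "v \<in> sphere 0 1 \<inter> S"
    and max: "\<And>y. y \<in> sphere 0 1 \<inter> S \<Longrightarrow> f y \<bullet> y \<le> f v \<bullet> v"
    using continuous_attains_sup[of "sphere 0 1 \<inter> S" "\<lambda>x. f x \<bullet> x"] by blast
  define l where "l = f v \<bullet> v"
  have vv: "v \<bullet> v = 1" using v by (simp add: norm_eq_1)
  have le: "f x \<bullet> x \<le> l * (x \<bullet> x)" if "x \<in> S" for x
  proof (cases "x = 0")
    case False
    have "f (x /\<^sub>R norm x) \<bullet> (x /\<^sub>R norm x) \<le> l"
      unfolding l_def using False that S by (intro max) (auto simp: subspace_scale)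
    then show ?thesis using False
      by (simp add: scale dot_square_norm power2_eq_square field_simps)
  qed (simp add: zero)
  \<comment> \<open>The part of \<open>f v\<close> orthogonal to \<open>v\<close>. Moving
    \<open>v\<close> towards \<open>w\<close>, which stays in \<open>S\<close> by invariance, cannot
    raise the quotient to first order, and this forces \<open>w = 0\<close>.\<close>
  define w where "w = f v - l *\<^sub>R v"
  have wS: "w \<in> S" using v S unfolding w_def by (auto intro!: subspace_diff subspace_scale)
  have vw: "v \<bullet> w = 0" by (simp add: w_def l_def inner_diff_right vv inner_commute)
  have fvw: "f v \<bullet> w = w \<bullet> w" using vw by (simp add: w_def inner_diff_left inner_diff_right inner_commute)
  have "w \<bullet> w = 0"
  proof (rule quadratic_growth_imp_zero)
    fix e :: real
    have "v + e *\<^sub>R w \<in> S" using v wS S by (auto intro!: subspace_add subspace_scale)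
    from le[OF this] have "f v \<bullet> v + e * (f w \<bullet> v) + e * (f v \<bullet> w) + e * e * (f w \<bullet> w)
        \<le> l * (1 + e\<^sup>2 * (w \<bullet> w))"
      using vw inner_commute[of v w]
      by (simp add: add scale inner_add_left inner_add_right vv power2_eq_square algebra_simps)
    moreover have "f w \<bullet> v = f v \<bullet> w" using adj[of w v] inner_commute[of w "f v"] by simp
    ultimately have "l + 2 * e * (f v \<bullet> w) + e\<^sup>2 * (f w \<bullet> w) \<le> l * (1 + e\<^sup>2 * (w \<bullet> w))"
      by (simp add: l_def power2_eq_square algebra_simps)
    then show "2 * e * (w \<bullet> w) \<le> e\<^sup>2 * (l * (w \<bullet> w) - f w \<bullet> w)"
      by (simp add: fvw algebra_simps)
  qed
  then have "f v = l *\<^sub>R v" by (simp add: w_def)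
  then show ?thesis using v that[of v l] by simp
qed

text \<open>Take an orthonormal set of eigenvectors of largest cardinality. Its orthogonal
  complement is invariant, so if nonzero it would contain one more eigenvector.\<close>

lemma symmetric_matrix_diagonalizable:
  fixes Q :: "real ^ 'n ^ 'n"
  assumes "transpose Q = Q"
  obtains P :: "real ^ 'n ^ 'n" where "orthogonal_matrix P"
    "\<And>i j. i \<noteq> j \<Longrightarrow> (transpose P ** Q ** P) $ i $ j = 0"
proof -
  have adj: "(Q *v x) \<bullet> y = x \<bullet> (Q *v y)" for x y
    using dot_lmul_matrix[of x Q y] transpose_matrix_vector[of Q x] assms by simp
  define good where "good E \<longleftrightarrow> pairwise orthogonal E \<and>
    (\<forall>v\<in>E. norm v = 1 \<and> (\<exists>l. Q *v v = l *\<^sub>R v))" for E :: "(real ^ 'n) set"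
  have ind: "independent E" if "good E" for E
    using that by (intro pairwise_orthogonal_independent) (auto simp: good_def)
  have bound: "finite E \<and> card E \<le> CARD('n)" if "good E" for E
    using independent_bound[OF ind[OF that]] by simp
  have "good {}" by (simp add: good_def)
  then obtain E where E: "good E" and max: "\<And>E'. good E' \<Longrightarrow> card E' \<le> card E"
    using ex_has_greatest_nat[of good "{}" card "Suc CARD('n)"] bound by (metis less_Suc_eq_le)
  define S where "S = {x. \<forall>v\<in>E. orthogonal v x}"
  have subS: "subspace S"
    unfolding S_def by (rule subspace_orthogonal_to_vectors)
  have "S = {0}"
  proof (rule ccontr)
    assume "S \<noteq> {0}"
    have "(*v) Q ` S \<subseteq> S"
    proof clarify
      fix x assume x: "x \<in> S"
      show "Q *v x \<in> S" unfolding S_def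
      proof clarify
        fix v assume v: "v \<in> E"
        then obtain l where "Q *v v = l *\<^sub>R v" using E by (auto simp: good_def)
        then have "v \<bullet> (Q *v x) = l * (v \<bullet> x)" by (simp add: adj[symmetric])
        then show "orthogonal v (Q *v x)" using x v by (simp add: S_def orthogonal_def)
      qed
    qed
    from selfadjoint_eigenvector[OF matrix_vector_mul_linear adj subS \<open>S \<noteq> {0}\<close> this]
    obtain v l where v: "v \<in> S" "norm v = 1" "Q *v v = l *\<^sub>R v" by blast
    have "v \<notin> E" using v by (auto simp: S_def orthogonal_def norm_eq_1)
    moreover have "good (insert v E)"
      using E v by (auto simp: good_def pairwise_insert S_def orthogonal_commute)
    ultimately show False using max[of "insert v E"] bound[OF E] by simp
  qed
  have "span E = UNIV"
  proof (rule ccontr)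
    assume "span E \<noteq> UNIV"
    then obtain x where "x \<noteq> 0" "\<And>y. y \<in> span E \<Longrightarrow> orthogonal x y"
      using orthogonal_to_subspace_exists_gen[of E UNIV] by (metis psubsetI span_UNIV top_greatest)
    then have "x \<in> S" by (auto simp: S_def orthogonal_commute span_base)
    then show False using \<open>S = {0}\<close> \<open>x \<noteq> 0\<close> by simp
  qed
  then have "card E = CARD('n)"
    using dim_eq_card_independent[OF ind[OF E]] dim_span[of E] by (simp add: dim_UNIV)
  then obtain b where b: "bij_betw b (UNIV :: 'n set) E"
    using bound[OF E] finite_same_card_bij[of "UNIV :: 'n set" E] by auto
  have bE: "b i \<in> E" for i using b by (auto simp: bij_betw_def)
  have orth: "b i \<bullet> b j = (if i = j then 1 else 0)" for i j
  proof (cases "i = j")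
    case False
    then have "b i \<noteq> b j" using b by (auto simp: bij_betw_def inj_on_def)
    then show ?thesis using False E bE by (auto simp: good_def pairwise_def orthogonal_def)
  qed (use E bE in \<open>auto simp: good_def norm_eq_1\<close>)
  define P where "P = (\<chi> i j. b j $ i)"
  have "transpose P ** P = mat 1"
    using orth by (simp add: vec_eq_iff P_def matrix_matrix_mult_def transpose_def mat_def inner_vec_def)
  then have "orthogonal_matrix P" by (simp add: orthogonal_matrix)
  moreover have "(transpose P ** Q ** P) $ i $ j = 0" if "i \<noteq> j" for i j
  proof -
    have "(transpose P ** Q ** P) $ i $ j = b i \<bullet> (Q *v b j)"
      by (subst matrix_mul_assoc[symmetric])
        (simp add: P_def matrix_matrix_mult_def transpose_def inner_vec_def matrix_vector_mult_def)
    moreover obtain l where "Q *v b j = l *\<^sub>R b j" using E bE by (auto simp: good_def)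
    ultimately show ?thesis using that orth by simp
  qed
  ultimately show ?thesis by (rule that)
qed

section \<open>Nonsingular matrices under linear trace conditions\<close>

lemma orthogonal_triple_nonzero_entries:
  fixes l m n :: real
  assumes "l \<noteq> 0" "m \<noteq> 0"
  shows "\<exists>a b c. l * a + m * b + n * c = 0 \<and> a * b * c \<noteq> 0"
proof -
  \<comment> \<open>With \<open>b = 1\<close> the equation is solved for \<open>a\<close>, so
    \<open>c\<close> only has to avoid 0 and a root of \<open>m + n * c\<close>.\<close>
  obtain c where c: "c \<noteq> 0" "m + n * c \<noteq> 0"
  proof (cases "m + n = 0")
    case True
    then show ?thesis using that[of 2] assms by (simp add: add_eq_0_iff2)
  qed (use that[of 1] in simp)
  show ?thesis
    by (intro exI[of _ "- (m + n * c) / l"] exI[of _ 1] exI[of _ c]) (use assms c in simp)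
qed

text \<open>The points (0,0), (1,0) and (0,1) kill the mixed term and isolate \<open>x\<close>,
  \<open>e\<close> and \<open>f\<close>.\<close>

lemma quadratic_not_constant:
  fixes x h e f :: real
  assumes "e \<noteq> 0 \<or> f \<noteq> 0"
  shows "\<exists>b c. x - (e * b\<^sup>2 + f * c\<^sup>2) + 2 * h * b * c \<noteq> 0"
proof (rule ccontr)
  assume "\<not> ?thesis"
  then have *: "x - (e * b\<^sup>2 + f * c\<^sup>2) + 2 * h * b * c = 0" for b c by blast
  show False using *[of 0 0] *[of 1 0] *[of 0 1] assms by simp
qed

text \<open>The cubic is the determinant of the symmetric matrix with diagonal \<open>k d\<close> and off-diagonal
  entries \<open>a, b, c\<close>. It does not vanish on a hyperplane because no linear form divides it.\<close>

lemma cubic_nonzero_on_hyperplane: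
  fixes d\<^sub>1 d\<^sub>2 d\<^sub>3 k\<^sub>0 l m n :: real
  assumes sum: "d\<^sub>1 + d\<^sub>2 + d\<^sub>3 = 0" and d: "d\<^sub>1 \<noteq> 0 \<or> d\<^sub>2 \<noteq> 0 \<or> d\<^sub>3 \<noteq> 0"
  shows "\<exists>k a b c. k\<^sub>0 * k + l * a + m * b + n * c = 0 \<and>
    k ^ 3 * d\<^sub>1 * d\<^sub>2 * d\<^sub>3 - k * (d\<^sub>1 * a\<^sup>2 + d\<^sub>2 * b\<^sup>2 + d\<^sub>3 * c\<^sup>2) + 2 * a * b * c \<noteq> 0"
proof -
  \<comment> \<open>If none or at least two of \<open>l\<close>, \<open>m\<close>, \<open>n\<close>
    are nonzero, \<open>k = 0\<close> with nonzero \<open>a * b * c\<close> works. If exactly one is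
    nonzero, \<open>k = 0\<close> would force its variable, hence the cubic, to vanish; there
    \<open>k = 1\<close> fixes this variable as \<open>h\<close> and leaves a nonzero quadratic
    polynomial in the other two.\<close>
  consider "\<exists>a b c. l * a + m * b + n * c = 0 \<and> a * b * c \<noteq> 0"
    | "l \<noteq> 0" "m = 0" "n = 0" | "m \<noteq> 0" "n = 0" "l = 0" | "n \<noteq> 0" "l = 0" "m = 0"
  proof -
    have "\<exists>a b c. l * a + m * b + n * c = 0 \<and> a * b * c \<noteq> 0"
      if "l = 0" "m = 0" "n = 0"
      using that by (intro exI[of _ 1]) simp
    moreover have "\<exists>a b c. l * a + m * b + n * c = 0 \<and> a * b * c \<noteq> 0"
      if "m \<noteq> 0" "n \<noteq> 0"
    proof -
      from orthogonal_triple_nonzero_entries[OF that, of l]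
      obtain b c a where "m * b + n * c + l * a = 0" "b * c * a \<noteq> 0" by blast
      then show ?thesis by (intro exI[of _ a] exI[of _ b] exI[of _ c]) (simp add: algebra_simps)
    qed
    moreover have "\<exists>a b c. l * a + m * b + n * c = 0 \<and> a * b * c \<noteq> 0"
      if "l \<noteq> 0" "n \<noteq> 0"
    proof -
      from orthogonal_triple_nonzero_entries[OF that, of m]
      obtain a c b where "l * a + n * c + m * b = 0" "a * c * b \<noteq> 0" by blast
      then show ?thesis by (intro exI[of _ a] exI[of _ b] exI[of _ c]) (simp add: algebra_simps)
    qed
    moreover note orthogonal_triple_nonzero_entries[of l m n]
    ultimately show ?thesis using that by blast
  qed
  then show ?thesis
  proof cases
    case 1
    then obtain a b c where "l * a + m * b + n * c = 0" "a * b * c \<noteq> 0" by blast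
    then show ?thesis by (intro exI[of _ 0] exI[of _ a] exI[of _ b] exI[of _ c]) simp
  next
    case 2
    define h where "h = - k\<^sub>0 / l"
    obtain b c where "d\<^sub>1 * d\<^sub>2 * d\<^sub>3 - d\<^sub>1 * h\<^sup>2 - (d\<^sub>2 * b\<^sup>2 + d\<^sub>3 * c\<^sup>2) + 2 * h * b * c \<noteq> 0"
      using quadratic_not_constant[of d\<^sub>2 d\<^sub>3] sum d by fastforce
    then show ?thesis using 2
      by (intro exI[of _ 1] exI[of _ h] exI[of _ b] exI[of _ c]) (simp add: h_def algebra_simps)
  next
    case 3
    define h where "h = - k\<^sub>0 / m"
    obtain a c where "d\<^sub>1 * d\<^sub>2 * d\<^sub>3 - d\<^sub>2 * h\<^sup>2 - (d\<^sub>1 * a\<^sup>2 + d\<^sub>3 * c\<^sup>2) + 2 * h * a * c \<noteq> 0"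
      using quadratic_not_constant[of d\<^sub>1 d\<^sub>3] sum d by fastforce
    then show ?thesis using 3
      by (intro exI[of _ 1] exI[of _ a] exI[of _ h] exI[of _ c]) (simp add: h_def algebra_simps)
  next
    case 4
    define h where "h = - k\<^sub>0 / n"
    obtain a b where "d\<^sub>1 * d\<^sub>2 * d\<^sub>3 - d\<^sub>3 * h\<^sup>2 - (d\<^sub>1 * a\<^sup>2 + d\<^sub>2 * b\<^sup>2) + 2 * h * a * b \<noteq> 0"
      using quadratic_not_constant[of d\<^sub>1 d\<^sub>2] sum d by fastforce
    then show ?thesis using 4
      by (intro exI[of _ 1] exI[of _ a] exI[of _ b] exI[of _ h]) (simp add: h_def algebra_simps)
  qed
qed

text \<open>For diagonal \<open>A\<close> the conditions on \<open>trace Q\<close> and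
  \<open>trace (A ** Q)\<close> constrain only the diagonal of \<open>Q\<close>, and
  \<open>trace (B ** Q) = 0\<close> is one hyperplane in the remaining parameters. For scalar
  \<open>A\<close> the ansatz has zero diagonal and determinant \<open>2 * a * b * c\<close>, which
  a hyperplane may annihilate; the hypothesis \<open>scalar\<close> makes that last condition
  empty.\<close>

lemma traceless_annihilator_of_diagonal:
  fixes A B :: "real ^ 3 ^ 3"
  assumes A: "\<And>i j. i \<noteq> j \<Longrightarrow> A $ i $ j = 0" and B: "transpose B = B"
    and scalar: "(\<And>i. A $ i $ i = A $ 1 $ 1) \<Longrightarrow> (\<And>i j. i \<noteq> j \<Longrightarrow> B $ i $ j = 0)"
  obtains Q :: "real ^ 3 ^ 3" where "transpose Q = Q" "det Q \<noteq> 0" "trace Q = 0"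
    "trace (A ** Q) = 0" "trace (B ** Q) = 0"
proof -
  \<comment> \<open>Up to sign the cross product of (1,1,1) with the diagonal of \<open>A\<close>,
    hence orthogonal to both.\<close>
  define d\<^sub>1 d\<^sub>2 d\<^sub>3 where "d\<^sub>1 = A $ 2 $ 2 - A $ 3 $ 3" and "d\<^sub>2 = A $ 3 $ 3 - A $ 1 $ 1"
    and "d\<^sub>3 = A $ 1 $ 1 - A $ 2 $ 2"
  define Q where "Q k a b c = (vector [vector [k * d\<^sub>1, c, b], vector [c, k * d\<^sub>2, a],
    vector [b, a, k * d\<^sub>3]] :: real ^ 3 ^ 3)" for k a b c
  have nondiag: "A $ 1 $ 2 = 0" "A $ 1 $ 3 = 0" "A $ 2 $ 1 = 0" "A $ 2 $ 3 = 0" "A $ 3 $ 1 = 0"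
      "A $ 3 $ 2 = 0"
    by (simp_all add: A)
  have sym: "B $ i $ j = B $ j $ i" for i j
    using arg_cong[OF B, of "\<lambda>X. X $ j $ i"] by (simp add: transpose_def)
  have "\<exists>k a b c. trace (B ** Q k a b c) = 0 \<and> det (Q k a b c) \<noteq> 0"
  proof (cases "d\<^sub>1 = 0 \<and> d\<^sub>2 = 0 \<and> d\<^sub>3 = 0")
    case True
    then have "A $ 2 $ 2 = A $ 1 $ 1" "A $ 3 $ 3 = A $ 1 $ 1"
      by (simp_all add: d\<^sub>2_def d\<^sub>3_def)
    then have "A $ i $ i = A $ 1 $ 1" for i
      using exhaust_3[of i] by metis
    then have "B $ 1 $ 2 = 0" "B $ 1 $ 3 = 0" "B $ 2 $ 1 = 0" "B $ 2 $ 3 = 0" "B $ 3 $ 1 = 0"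
      "B $ 3 $ 2 = 0" by (simp_all add: scalar)
    then have "trace (B ** Q 0 1 1 1) = 0 \<and> det (Q 0 1 1 1) \<noteq> 0"
      by (simp add: Q_def trace_def matrix_matrix_mult_def sum_3 det_3)
    then show ?thesis by blast
  next
    case False
    have "d\<^sub>1 + d\<^sub>2 + d\<^sub>3 = 0" by (simp add: d\<^sub>1_def d\<^sub>2_def d\<^sub>3_def)
    from cubic_nonzero_on_hyperplane[OF this, of
        "B $ 1 $ 1 * d\<^sub>1 + B $ 2 $ 2 * d\<^sub>2 + B $ 3 $ 3 * d\<^sub>3"
        "2 * B $ 2 $ 3" "2 * B $ 1 $ 3" "2 * B $ 1 $ 2"] False
    obtain k a b c where
      "(B $ 1 $ 1 * d\<^sub>1 + B $ 2 $ 2 * d\<^sub>2 + B $ 3 $ 3 * d\<^sub>3) * k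
        + 2 * B $ 2 $ 3 * a + 2 * B $ 1 $ 3 * b + 2 * B $ 1 $ 2 * c = 0"
      "k ^ 3 * d\<^sub>1 * d\<^sub>2 * d\<^sub>3 - k * (d\<^sub>1 * a\<^sup>2 + d\<^sub>2 * b\<^sup>2 + d\<^sub>3 * c\<^sup>2) + 2 * a * b * c \<noteq> 0"
      by blast
    then have "trace (B ** Q k a b c) = 0 \<and> det (Q k a b c) \<noteq> 0"
      using sym[of 2 1] sym[of 3 1] sym[of 3 2]
      by (simp add: Q_def trace_def matrix_matrix_mult_def sum_3 det_3 power2_eq_square
          power3_eq_cube algebra_simps)
    then show ?thesis by blast
  qed
  then obtain k a b c where "trace (B ** Q k a b c) = 0" "det (Q k a b c) \<noteq> 0" by blast
  moreover have "transpose (Q k a b c) = Q k a b c"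
    by (simp add: Q_def transpose_def vec_eq_iff forall_3)
  moreover have "trace (Q k a b c) = 0"
    by (simp add: Q_def trace_def sum_3 d\<^sub>1_def d\<^sub>2_def d\<^sub>3_def algebra_simps)
  moreover have "trace (A ** Q k a b c) = 0"
    by (simp add: Q_def trace_def matrix_matrix_mult_def sum_3 nondiag d\<^sub>1_def d\<^sub>2_def d\<^sub>3_def
        algebra_simps)
  ultimately show ?thesis by (intro that)
qed

section \<open>A common frame for two real symmetric matrices\<close>

lemma transpose_conjugate_symmetric:
  fixes Q P :: "'a::comm_semiring_1 ^ 'n ^ 'n"
  assumes "transpose Q = Q"
  shows "transpose (transpose P ** Q ** P) = transpose P ** Q ** P"
  using assms by (simp add: matrix_transpose_mul matrix_mul_assoc)

lemma trace_mult_diagonal: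
  fixes X D :: "'a::semiring_1 ^ 'n ^ 'n"
  assumes "\<And>i j. i \<noteq> j \<Longrightarrow> D $ i $ j = 0"
  shows "trace (X ** D) = (\<Sum>i\<in>UNIV. X $ i $ i * D $ i $ i)"
proof -
  have "(\<Sum>k\<in>UNIV. X $ i $ k * D $ k $ i) = (\<Sum>k\<in>{i}. X $ i $ k * D $ k $ i)" for i
    by (rule sum.mono_neutral_right) (auto simp: assms)
  then show ?thesis by (simp add: trace_def matrix_matrix_mult_def)
qed

text \<open>Two changes of basis are composed: \<open>R\<close> makes \<open>A\<close> diagonal, and
  \<open>S\<close> diagonalizes the matrix \<open>Q\<close> that annihilates both transformed
  matrices. The weights \<open>q\<close> are the eigenvalues of \<open>Q\<close>.\<close>

lemma symmetric_pair_annihilated_frame: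
  fixes A B :: "real ^ 3 ^ 3"
  assumes A: "transpose A = A" and B: "transpose B = B"
  obtains P :: "real ^ 3 ^ 3" and q :: "3 \<Rightarrow> real" where "orthogonal_matrix P"
    "\<And>i. q i \<noteq> 0" "(\<Sum>i\<in>UNIV. q i) = 0"
    "(\<Sum>i\<in>UNIV. q i * (transpose P ** A ** P) $ i $ i) = 0"
    "(\<Sum>i\<in>UNIV. q i * (transpose P ** B ** P) $ i $ i) = 0"
proof -
  have "\<exists>R :: real ^ 3 ^ 3. orthogonal_matrix R \<and>
    (\<forall>i j. i \<noteq> j \<longrightarrow> (transpose R ** A ** R) $ i $ j = 0) \<and>
    ((\<forall>i. (transpose R ** A ** R) $ i $ i = (transpose R ** A ** R) $ 1 $ 1) \<longrightarrow>
      (\<forall>i j. i \<noteq> j \<longrightarrow> (transpose R ** B ** R) $ i $ j = 0))"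
  proof -
    obtain R where R: "orthogonal_matrix R"
      and d: "\<And>i j. i \<noteq> j \<Longrightarrow> (transpose R ** A ** R) $ i $ j = 0"
      using symmetric_matrix_diagonalizable[OF A] by blast
    define A' where "A' = transpose R ** A ** R"
    show ?thesis
    proof (cases "\<forall>i. A' $ i $ i = A' $ 1 $ 1")
      case False
      then show ?thesis using R d unfolding A'_def by blast
    next
      case True
      \<comment> \<open>A scalar \<open>A\<close> is unchanged by every orthogonal conjugation, so
        the basis is free to diagonalize \<open>B\<close> instead.\<close>
      define l where "l = A' $ 1 $ 1"
      have "A' = mat l" using True d by (simp add: vec_eq_iff mat_def A'_def[symmetric] l_def)
      have conj: "transpose S ** mat l ** S = mat l" if "orthogonal_matrix S" for S :: "real ^ 3 ^ 3"
      proof -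
        have "transpose S ** mat l ** S = l *\<^sub>R (transpose S ** S)"
          by (simp add: vec_eq_iff matrix_matrix_mult_def mat_def sum_3 forall_3 algebra_simps)
        also have "\<dots> = mat l"
          using that by (simp add: orthogonal_matrix vec_eq_iff mat_def)
        finally show ?thesis .
      qed
      have "A = (R ** transpose R) ** A ** (R ** transpose R)"
        using R by (simp add: orthogonal_matrix_def)
      also have "\<dots> = R ** A' ** transpose R"
        by (simp add: A'_def matrix_mul_assoc)
      also have "\<dots> = mat l"
        using conj[of "transpose R"] R \<open>A' = mat l\<close> by (simp add: orthogonal_matrix_transpose)
      finally have "A = mat l" .
      obtain S where S: "orthogonal_matrix S"
        and dS: "\<And>i j. i \<noteq> j \<Longrightarrow> (transpose S ** B ** S) $ i $ j = 0"
        using symmetric_matrix_diagonalizable[OF B] by blast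
      show ?thesis
        using S dS \<open>A = mat l\<close> conj[OF S] by (intro exI[of _ S]) (simp add: mat_def)
    qed
  qed
  then obtain R :: "real ^ 3 ^ 3" where R: "orthogonal_matrix R"
    and diag: "\<forall>i j. i \<noteq> j \<longrightarrow> (transpose R ** A ** R) $ i $ j = 0"
    and scalar: "(\<forall>i. (transpose R ** A ** R) $ i $ i = (transpose R ** A ** R) $ 1 $ 1) \<longrightarrow>
      (\<forall>i j. i \<noteq> j \<longrightarrow> (transpose R ** B ** R) $ i $ j = 0)"
    by (elim exE conjE)
  define A' B' where A': "A' = transpose R ** A ** R" and B': "B' = transpose R ** B ** R"
  have sym: "transpose B' = B'" unfolding B' by (rule transpose_conjugate_symmetric[OF B])
  have diag': "A' $ i $ j = 0" if "i \<noteq> j" for i j using diag that by (simp add: A')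
  have scalar': "B' $ i $ j = 0" if "\<And>i. A' $ i $ i = A' $ 1 $ 1" "i \<noteq> j" for i j
    using scalar that unfolding A' B' by blast
  obtain Q :: "real ^ 3 ^ 3" where Q: "transpose Q = Q" "det Q \<noteq> 0" "trace Q = 0"
    "trace (A' ** Q) = 0" "trace (B' ** Q) = 0"
    using diag' sym scalar' by (rule traceless_annihilator_of_diagonal[of A' B'])
  obtain S where S: "orthogonal_matrix S"
    and dS: "\<And>i j. i \<noteq> j \<Longrightarrow> (transpose S ** Q ** S) $ i $ j = 0"
    using symmetric_matrix_diagonalizable[OF Q(1)] by blast
  define D where "D = transpose S ** Q ** S"
  have SS: "S ** transpose S = mat 1" "transpose S ** S = mat 1"
    using S by (auto simp: orthogonal_matrix_def)
  \<comment> \<open>The diagonal of \<open>D\<close> holds the eigenvalues of \<open>Q\<close>; this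
    identity turns the trace conditions into relations among diagonal entries in the
    eigenbasis.\<close>
  have trD: "(\<Sum>i\<in>UNIV. D $ i $ i * (transpose S ** X ** S) $ i $ i) = trace (X ** Q)" for X
  proof -
    have "Q = (S ** transpose S) ** Q ** (S ** transpose S)" by (simp add: SS)
    also have "\<dots> = S ** D ** transpose S" by (simp add: D_def matrix_mul_assoc)
    finally have "trace (X ** Q) = trace ((X ** S ** D) ** transpose S)" by (simp add: matrix_mul_assoc)
    also have "\<dots> = trace ((transpose S ** X ** S) ** D)"
      by (subst trace_mul_sym) (simp add: matrix_mul_assoc)
    also have "\<dots> = (\<Sum>i\<in>UNIV. D $ i $ i * (transpose S ** X ** S) $ i $ i)"
      using dS by (subst trace_mult_diagonal) (simp_all add: D_def mult.commute)
    finally show ?thesis by simp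
  qed
  have "det D = (\<Prod>i\<in>UNIV. D $ i $ i)" using dS by (intro det_diagonal) (simp add: D_def)
  moreover have "det D = det Q"
    using det_orthogonal_matrix[OF S] by (auto simp: D_def det_mul det_transpose)
  ultimately have "D $ i $ i \<noteq> 0" for i using Q(2) by simp
  moreover have "(\<Sum>i\<in>UNIV. D $ i $ i) = 0"
    using Q(3) by (simp add: D_def trace_mul_sym[of _ S] matrix_mul_assoc SS flip: trace_def)
  moreover have "transpose (R ** S) ** X ** (R ** S) = transpose S ** (transpose R ** X ** R) ** S" for X
    by (simp add: matrix_transpose_mul matrix_mul_assoc)
  ultimately have "(\<Sum>i\<in>UNIV. D $ i $ i * (transpose (R ** S) ** A ** (R ** S)) $ i $ i) = 0"
    "(\<Sum>i\<in>UNIV. D $ i $ i * (transpose (R ** S) ** B ** (R ** S)) $ i $ i) = 0"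
    "\<And>i. D $ i $ i \<noteq> 0" "(\<Sum>i\<in>UNIV. D $ i $ i) = 0"
    using trD[of A'] trD[of B'] Q(4,5) A' B' by simp_all
  then show ?thesis by (intro that[of "R ** S" "\<lambda>i. D $ i $ i"] orthogonal_matrix_mul R S)
qed

text \<open>Two of three nonzero reals share a sign. Bringing these to the places 1 and 2 is what
  later makes both weights of the mean positive.\<close>

lemma sum_zero_triple_permutation:
  fixes q :: "3 \<Rightarrow> real"
  assumes "\<And>i. q i \<noteq> 0" "(\<Sum>i\<in>UNIV. q i) = 0"
  obtains \<sigma> :: "3 \<Rightarrow> 3" where "bij \<sigma>" "q (\<sigma> 1) * q (\<sigma> 2) > 0"
proof -
  have "\<exists>\<sigma> :: 3 \<Rightarrow> 3. bij \<sigma> \<and> q (\<sigma> 1) * q (\<sigma> 2) > 0"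
  proof -
    consider "q 1 * q 2 > 0" | "q 3 * q 2 > 0" | "q 1 * q 3 > 0"
      using assms(1)[of 1] assms(1)[of 2] assms(1)[of 3]
      by (auto simp: zero_less_mult_iff not_less neq_iff)
    then show ?thesis
    proof cases
      case 1
      then show ?thesis by (intro exI[of _ id]) simp
    next
      case 2
      then show ?thesis by (intro exI[of _ "Transposition.transpose 1 3"]) simp
    next
      case 3
      then show ?thesis by (intro exI[of _ "Transposition.transpose 2 3"]) simp
    qed
  qed
  then show ?thesis using that by blast
qed


text \<open>After the permutation the weights are \<open>u\<close>, \<open>v\<close> and
  \<open>- (u + v)\<close> with \<open>u\<close>, \<open>v\<close> of one sign. Division by
  \<open>u + v\<close> gives the same convex combination for the real and the imaginary parts, with
  \<open>p\<close> and \<open>q\<close> the square roots of its coefficients.\<close>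

lemma complex_symmetric_frame:
  fixes M :: "complex ^ 3 ^ 3"
  assumes "transpose M = M"
  obtains V :: "complex ^ 3 ^ 3" and p q :: real
  where "\<forall>i j. V $ i $ j \<in> \<real>" "transpose V ** V = mat 1" "p > 0" "q > 0" "p\<^sup>2 + q\<^sup>2 = 1"
    "(transpose V ** M ** V) $ 3 $ 3 =
      of_real (p\<^sup>2) * (transpose V ** M ** V) $ 1 $ 1 + of_real (q\<^sup>2) * (transpose V ** M ** V) $ 2 $ 2"
proof -
  define A B where "A = (\<chi> i j. Re (M $ i $ j))" and "B = (\<chi> i j. Im (M $ i $ j))"
  have sym: "M $ i $ j = M $ j $ i" for i j
    using arg_cong[OF assms, of "\<lambda>X. X $ j $ i"] by (simp add: transpose_def)
  have "transpose A = A" "transpose B = B"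
    using sym by (simp_all add: A_def B_def transpose_def vec_eq_iff)
  then obtain P :: "real ^ 3 ^ 3" and w :: "3 \<Rightarrow> real" where P: "orthogonal_matrix P"
    and w: "\<And>i. w i \<noteq> 0" "(\<Sum>i\<in>UNIV. w i) = 0"
    and wA: "(\<Sum>i\<in>UNIV. w i * (transpose P ** A ** P) $ i $ i) = 0"
    and wB: "(\<Sum>i\<in>UNIV. w i * (transpose P ** B ** P) $ i $ i) = 0"
    using symmetric_pair_annihilated_frame by blast
  obtain \<sigma> :: "3 \<Rightarrow> 3" where \<sigma>: "bij \<sigma>" "w (\<sigma> 1) * w (\<sigma> 2) > 0"
    using sum_zero_triple_permutation[OF w] by blast
  define V where "V = (\<chi> i j. complex_of_real (P $ i $ \<sigma> j))"
  have entry: "(transpose V ** M ** V) $ i $ j =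
      Complex ((transpose P ** A ** P) $ \<sigma> i $ \<sigma> j) ((transpose P ** B ** P) $ \<sigma> i $ \<sigma> j)" for i j
    by (simp add: V_def A_def B_def matrix_matrix_mult_def transpose_def complex_eq_iff)
  define u v where "u = w (\<sigma> 1)" and "v = w (\<sigma> 2)"
  have uv: "u * v > 0" "u + v \<noteq> 0" "u / (u + v) > 0" "v / (u + v) > 0"
    using \<sigma>(2) by (auto simp: u_def v_def zero_less_mult_iff zero_less_divide_iff)
  have sum\<sigma>: "(\<Sum>i\<in>UNIV. f i) = f (\<sigma> 1) + f (\<sigma> 2) + f (\<sigma> 3)" for f :: "3 \<Rightarrow> real"
    using sum.reindex_bij_betw[OF \<sigma>(1), of f] by (simp add: sum_3)
  have w3: "w (\<sigma> 3) = - (u + v)" using w(2) sum\<sigma>[of w] by (simp add: u_def v_def)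
  have mean: "x\<^sub>3 = u / (u + v) * x\<^sub>1 + v / (u + v) * x\<^sub>2"
    if "u * x\<^sub>1 + v * x\<^sub>2 + - (u + v) * x\<^sub>3 = 0" for x\<^sub>1 x\<^sub>2 x\<^sub>3
  proof -
    have "x\<^sub>3 * (u + v) = u * x\<^sub>1 + v * x\<^sub>2" using that by (simp add: algebra_simps)
    then have "x\<^sub>3 = (u * x\<^sub>1 + v * x\<^sub>2) / (u + v)" using uv(2) by (simp add: eq_divide_eq)
    then show ?thesis by (simp add: add_divide_distrib)
  qed
  show ?thesis
  proof (rule that[of V "sqrt (u / (u + v))" "sqrt (v / (u + v))"])
    show "\<forall>i j. V $ i $ j \<in> \<real>" by (simp add: V_def)
    have "(transpose P ** P) $ \<sigma> i $ \<sigma> j = mat 1 $ \<sigma> i $ \<sigma> j" for i j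
      using P by (simp add: orthogonal_matrix)
    then have "complex_of_real ((transpose P ** P) $ \<sigma> i $ \<sigma> j) = mat 1 $ i $ j" for i j
      using bij_is_inj[OF \<sigma>(1)] by (simp add: mat_def inj_eq)
    then show "transpose V ** V = mat 1"
      by (simp add: vec_eq_iff V_def matrix_matrix_mult_def transpose_def)
    show "sqrt (u / (u + v)) > 0" "sqrt (v / (u + v)) > 0" using uv by simp_all
    have "u / (u + v) + v / (u + v) = 1" using uv(2) by (simp flip: add_divide_distrib)
    then show "(sqrt (u / (u + v)))\<^sup>2 + (sqrt (v / (u + v)))\<^sup>2 = 1" using uv by simp
    have "u / (u + v) \<ge> 0" "v / (u + v) \<ge> 0" using uv by simp_all
    moreover note mean[OF wA[unfolded sum\<sigma> w3 u_def[symmetric] v_def[symmetric]]]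
      mean[OF wB[unfolded sum\<sigma> w3 u_def[symmetric] v_def[symmetric]]]
    ultimately show "(transpose V ** M ** V) $ 3 $ 3 =
      of_real ((sqrt (u / (u + v)))\<^sup>2) * (transpose V ** M ** V) $ 1 $ 1 +
      of_real ((sqrt (v / (u + v)))\<^sup>2) * (transpose V ** M ** V) $ 2 $ 2"
      unfolding entry complex_eq_iff by (simp del: times_divide_eq_left)
  qed
qed

section \<open>Boundary integrals of Hardy functions\<close>

lemma space_circle_measure [simp]: "space circle_measure = sphere 0 1"
  by (simp add: circle_measure_def space_restrict_space)

lemma sets_circle_measure: "sets circle_measure = sets (restrict_space borel (sphere 0 1))"
  by (simp add: circle_measure_def)

lemma borel_measurable_circleI:
  fixes f :: "complex \<Rightarrow> 'b::topological_space"
  assumes "continuous_on (sphere 0 1) f"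
  shows "f \<in> borel_measurable circle_measure"
  using borel_measurable_continuous_on_restrict[OF assms]
  by (simp cong: measurable_cong_sets add: sets_circle_measure)

lemma measurable_cis_circle:
  "cis \<in> measurable (uniform_measure lborel {0..2 * pi}) (restrict_space borel (sphere 0 1))"
proof -
  have "cis \<in> borel_measurable borel"
    by (intro borel_measurable_continuous_onI continuous_intros)
  then show ?thesis by (intro measurable_restrict_space2) (auto simp: measurable_def)
qed

lemma emeasure_circle_measure: "emeasure circle_measure (sphere 0 1) = 1"
proof -
  have "emeasure circle_measure (sphere 0 1) = emeasure (uniform_measure lborel {0..2 * pi}) UNIV"
    unfolding circle_measure_def
    using measurable_space[OF measurable_cis_circle]
    by (subst emeasure_distr[OF measurable_cis_circle])
      (auto simp: sets_restrict_space vimage_def)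
  also have "\<dots> = emeasure lborel {0..2 * pi} / emeasure lborel {0..2 * pi}"
    by (subst emeasure_uniform_measure) auto
  finally show ?thesis by (simp add: divide_ennreal)
qed

interpretation circle: finite_measure circle_measure
  by (rule finite_measureI) (simp add: emeasure_circle_measure)

lemma measure_circle_measure [simp]: "measure circle_measure (sphere 0 1) = 1"
  by (simp add: measure_def emeasure_circle_measure)

lemma AE_circleI: "(\<And>z. cmod z = 1 \<Longrightarrow> P z) \<Longrightarrow> AE z in circle_measure. P z"
  by (rule AE_I2) simp

lemma bounded_continuous_circle:
  fixes c :: "complex \<Rightarrow> complex"
  assumes "continuous_on (sphere 0 1) c"
  obtains K where "\<And>z. cmod z = 1 \<Longrightarrow> cmod (c z) \<le> K"
proof -
  have "compact (c ` sphere 0 1)"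
    by (rule compact_continuous_image[OF assms compact_sphere])
  then obtain K where K: "\<forall>w\<in>c ` sphere 0 1. cmod w \<le> K"
    using compact_imp_bounded bounded_iff by metis
  then have "cmod (c z) \<le> K" if "cmod z = 1" for z using that by simp
  then show ?thesis using that by blast
qed

lemma integrable_continuous_circle:
  fixes c :: "complex \<Rightarrow> complex"
  assumes "continuous_on (sphere 0 1) c"
  shows "integrable circle_measure c"
proof -
  obtain K where "\<And>z. cmod z = 1 \<Longrightarrow> cmod (c z) \<le> K"
    using bounded_continuous_circle[OF assms] by blast
  then show ?thesis
    by (intro circle.integrable_const_bound[of _ K] AE_circleI borel_measurable_circleI assms) auto
qed

text \<open>The antiderivative of \<open>cis (n * t)\<close> takes equal values at both ends of the
  period.\<close>

lemma integral_circle_power_Suc: "(\<integral>z. z ^ Suc k \<partial>circle_measure) = 0"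
proof -
  define n where "n = real (Suc k)"
  have n: "n > 0" by (simp add: n_def)
  have z: "(\<lambda>z::complex. z ^ Suc k) \<in> borel_measurable (restrict_space borel (sphere 0 1))"
    by (intro borel_measurable_continuous_on_restrict continuous_intros)
  have "(\<integral>z. z ^ Suc k \<partial>circle_measure) =
      (\<integral>t. cis t ^ Suc k \<partial>uniform_measure lborel {0..2 * pi})"
    unfolding circle_measure_def by (rule integral_distr[OF measurable_cis_circle z])
  also have "\<dots> = (\<integral>t. cis (n * t) \<partial>uniform_measure lborel {0..2 * pi})"
    by (intro Bochner_Integration.integral_cong refl) (simp only: Complex.DeMoivre n_def)
  also have "uniform_measure lborel {0..2 * pi} =
      density lborel (\<lambda>t. ennreal (indicator {0..2 * pi} t / (2 * pi)))"
    unfolding uniform_measure_def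
    by (intro density_cong) (auto split: split_indicator simp: divide_ennreal[of 1, simplified])
  also have "(\<integral>t. cis (n * t) \<partial>\<dots>) =
      (\<integral>t. (indicator {0..2 * pi} t / (2 * pi)) *\<^sub>R cis (n * t) \<partial>lborel)"
    by (intro integral_density) (auto intro!: borel_measurable_continuous_onI continuous_intros)
  also have "\<dots> = (\<integral>t. (1 / (2 * pi)) *\<^sub>R (indicator {0..2 * pi} t *\<^sub>R cis (n * t)) \<partial>lborel)"
    by simp
  also have "\<dots> = (1 / (2 * pi)) *\<^sub>R (\<integral>t. indicator {0..2 * pi} t *\<^sub>R cis (n * t) \<partial>lborel)"
    by (rule integral_scaleR_right)
  also have "(\<integral>t. indicator {0..2 * pi} t *\<^sub>R cis (n * t) \<partial>lborel) =
      cis (n * (2 * pi)) / (\<i> * n) - cis (n * 0) / (\<i> * n)"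
  proof (rule has_bochner_integral_integral_eq, rule has_bochner_integral_FTC_Icc)
    fix t :: real
    have "((\<lambda>w. exp (\<i> * n * w) / (\<i> * n)) has_field_derivative exp (\<i> * n * of_real t)) (at (of_real t))"
      using n by (auto intro!: derivative_eq_intros)
    from has_vector_derivative_real_field[OF this]
    show "((\<lambda>t. cis (n * t) / (\<i> * n)) has_vector_derivative cis (n * t)) (at t within {0..2 * pi})"
      by (simp add: cis_conv_exp mult.assoc)
  qed (auto intro!: continuous_intros)
  also have "cis (n * (2 * pi)) = 1"
    by (metis cis_multiple_2pi Ints_of_nat mult.commute n_def)
  finally show ?thesis by simp
qed

lemma integral_circle_power: "(\<integral>z. z ^ k \<partial>circle_measure) = (if k = 0 then 1 else 0)"
  by (cases k) (simp_all add: integral_circle_power_Suc del: power_Suc)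

lemma integral_circle_cnj: "(\<integral>z. cnj (f z) \<partial>circle_measure) = cnj (\<integral>z. f z \<partial>circle_measure)"
  by simp

text \<open>On the circle \<open>cnj z\<close> is the inverse of \<open>z\<close>, so the integrand
  reduces to a single power of \<open>z\<close> or its conjugate.\<close>

lemma integral_circle_monomial:
  "(\<integral>z. z ^ m * cnj z ^ n \<partial>circle_measure) = (if m = n then 1 else 0)"
proof -
  have *: "z ^ m * cnj z ^ n = (if n \<le> m then z ^ (m - n) else cnj (z ^ (n - m)))"
    if "cmod z = 1" for z
  proof -
    have zz: "z * cnj z = 1" using that by (simp add: complex_norm_square[symmetric])
    show ?thesis
    proof (cases "n \<le> m")
      case True
      then have "z ^ m = z ^ (m - n) * z ^ n" by (simp flip: power_add)
      then show ?thesis using True zz by (simp add: mult.assoc flip: power_mult_distrib)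
    next
      case False
      then have "cnj z ^ n = cnj z ^ m * cnj z ^ (n - m)" by (simp flip: power_add)
      then show ?thesis using False zz by (simp flip: power_mult_distrib mult.assoc)
    qed
  qed
  have "(\<integral>z. z ^ m * cnj z ^ n \<partial>circle_measure) =
      (\<integral>z. (if n \<le> m then z ^ (m - n) else cnj (z ^ (n - m))) \<partial>circle_measure)"
    by (rule Bochner_Integration.integral_cong) (simp_all add: *)
  also have "\<dots> = (if m = n then 1 else 0)"
    by (cases "n \<le> m")
      (auto simp: integral_circle_power integral_circle_cnj simp del: complex_cnj_power)
  finally show ?thesis .
qed

section \<open>Limits of integrals under bounded square means\<close>

lemma (in finite_measure) integrable_of_square:
  fixes f :: "'a \<Rightarrow> complex"
  assumes "f \<in> borel_measurable M" "integrable M (\<lambda>x. (cmod (f x))\<^sup>2)"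
  shows "integrable M f"
proof (rule Bochner_Integration.integrable_bound)
  show "integrable M (\<lambda>x. 1 + (cmod (f x))\<^sup>2)" using assms by simp
  have "y \<le> 1 + y\<^sup>2" if "y \<ge> 0" for y :: real
    using sum_squares_bound[of 1 y] that by simp
  then show "AE x in M. norm (f x) \<le> norm (1 + (cmod (f x))\<^sup>2)" by simp
qed fact

text \<open>Convergence of the first moments comes from \<open>h \<le> min h K + h\<^sup>2 / K\<close>, applied to
  \<open>h = \<bar>u n - f\<bar>\<close>.\<close>

lemma (in finite_measure) bounded_square_integrals_tendsto:
  fixes u :: "nat \<Rightarrow> 'a \<Rightarrow> complex" and f b :: "'a \<Rightarrow> complex"
  assumes [measurable]: "\<And>n. u n \<in> borel_measurable M" "f \<in> borel_measurable M" "b \<in> borel_measurable M"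
    and u: "\<And>n. integrable M (\<lambda>x. (cmod (u n x))\<^sup>2)" "\<And>n. (\<integral>x. (cmod (u n x))\<^sup>2 \<partial>M) \<le> C"
    and f: "integrable M (\<lambda>x. (cmod (f x))\<^sup>2)"
    and lim: "AE x in M. (\<lambda>n. u n x) \<longlonglongrightarrow> f x"
    and b: "\<And>x. x \<in> space M \<Longrightarrow> cmod (b x) \<le> B"
  shows "(\<lambda>n. \<integral>x. u n x * b x \<partial>M) \<longlonglongrightarrow> (\<integral>x. f x * b x \<partial>M)"
proof -
  define h where "h n x = cmod (u n x - f x)" for n x
  have [measurable]: "h n \<in> borel_measurable M" for n unfolding h_def by measurable
  define C' where "C' = 2 * C + 2 * (\<integral>x. (cmod (f x))\<^sup>2 \<partial>M)"
  have hsq: "(h n x)\<^sup>2 \<le> 2 * (cmod (u n x))\<^sup>2 + 2 * (cmod (f x))\<^sup>2" for n x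
  proof -
    have "(h n x)\<^sup>2 \<le> (cmod (u n x) + cmod (f x))\<^sup>2"
      unfolding h_def by (intro power_mono norm_triangle_ineq4 norm_ge_zero)
    also have "\<dots> \<le> 2 * (cmod (u n x))\<^sup>2 + 2 * (cmod (f x))\<^sup>2"
      using sum_squares_bound[of "cmod (u n x)" "cmod (f x)"] by (simp add: power2_sum)
    finally show ?thesis .
  qed
  have inth2: "integrable M (\<lambda>x. (h n x)\<^sup>2)" for n
    by (rule Bochner_Integration.integrable_bound[of _ "\<lambda>x. 2 * (cmod (u n x))\<^sup>2 + 2 * (cmod (f x))\<^sup>2"])
      (use u f hsq in auto)
  have h2: "(\<integral>x. (h n x)\<^sup>2 \<partial>M) \<le> C'" for n
  proof -
    have "(\<integral>x. (h n x)\<^sup>2 \<partial>M) \<le> (\<integral>x. 2 * (cmod (u n x))\<^sup>2 + 2 * (cmod (f x))\<^sup>2 \<partial>M)"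
      using u f hsq inth2 by (intro integral_mono) auto
    also have "\<dots> = 2 * (\<integral>x. (cmod (u n x))\<^sup>2 \<partial>M) + 2 * (\<integral>x. (cmod (f x))\<^sup>2 \<partial>M)"
      using u(1) f by simp
    also have "\<dots> \<le> C'" using u(2)[of n] by (simp add: C'_def)
    finally show ?thesis .
  qed
  have inth: "integrable M (h n)" for n
    using integrable_of_square[of "\<lambda>x. complex_of_real (h n x)"] inth2[of n]
    by (simp add: h_def[abs_def] complex_of_real_integrable_eq)
  have "(\<lambda>n. \<integral>x. h n x \<partial>M) \<longlonglongrightarrow> 0"
  proof (rule LIMSEQ_I)
    fix e :: real assume e: "e > 0"
    \<comment> \<open>Chosen so that the tail \<open>C' / K\<close> is at most \<open>e / 2\<close>;
      the added 1 keeps \<open>K\<close> positive.\<close>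
    define K where "K = 2 * (\<bar>C'\<bar> + 1) / e"
    have K: "K > 0" using e by (simp add: K_def)
    have "(\<lambda>n. \<integral>x. min (h n x) K \<partial>M) \<longlonglongrightarrow> (\<integral>x. 0 \<partial>M)"
    proof (rule integral_dominated_convergence[where w = "\<lambda>_. K"])
      show "AE x in M. (\<lambda>n. min (h n x) K) \<longlonglongrightarrow> 0"
        using lim
      proof eventually_elim
        case (elim x)
        have "(\<lambda>n. h n x) \<longlonglongrightarrow> cmod (f x - f x)"
          unfolding h_def by (intro tendsto_intros elim)
        from tendsto_min[OF this tendsto_const[of K]] K show ?case by simp
      qed
      show "AE x in M. norm (min (h n x) K) \<le> K" for n
        using K by (auto simp: h_def)
    qed auto
    then obtain N where N: "\<And>n. n \<ge> N \<Longrightarrow> \<bar>\<integral>x. min (h n x) K \<partial>M\<bar> < e / 2"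
      using e by (fastforce dest!: LIMSEQ_D[where r = "e / 2"])
    have "\<bar>\<integral>x. h n x \<partial>M\<bar> < e" if "n \<ge> N" for n
    proof -
      have intm: "integrable M (\<lambda>x. min (h n x) K)"
        using K by (intro integrable_const_bound[of _ K]) (auto simp: h_def)
      have "h n x \<le> min (h n x) K + (h n x)\<^sup>2 / K" for x
      proof (cases "h n x \<le> K")
        case False
        then have "h n x * K \<le> (h n x)\<^sup>2" using K by (simp add: power2_eq_square mult_left_mono)
        then have "h n x \<le> (h n x)\<^sup>2 / K" using K by (simp add: pos_le_divide_eq)
        then show ?thesis using K False by simp
      qed (use K in simp)
      then have "(\<integral>x. h n x \<partial>M) \<le> (\<integral>x. min (h n x) K + (h n x)\<^sup>2 / K \<partial>M)"
        using inth inth2 intm by (intro integral_mono) auto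
      also have "\<dots> = (\<integral>x. min (h n x) K \<partial>M) + (\<integral>x. (h n x)\<^sup>2 \<partial>M) / K"
        using inth2 intm by simp
      also have "\<dots> \<le> (\<integral>x. min (h n x) K \<partial>M) + C' / K"
        using h2 K by (simp add: divide_right_mono)
      also have "\<dots> < e / 2 + C' / K" using N[OF that] by simp
      also have "C' / K \<le> e / 2"
      proof -
        have "C' * 2 \<le> e * K" using e by (simp add: K_def)
        then show ?thesis using K by (simp add: field_simps)
      qed
      finally have "(\<integral>x. h n x \<partial>M) < e" by simp
      moreover have "(\<integral>x. h n x \<partial>M) \<ge> 0" by (simp add: h_def)
      ultimately show ?thesis by simp
    qed
    then show "\<exists>N. \<forall>n\<ge>N. norm ((\<integral>x. h n x \<partial>M) - 0) < e" by auto
  qed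
  then have lim0: "(\<lambda>n. (\<integral>x. h n x \<partial>M) * \<bar>B\<bar>) \<longlonglongrightarrow> 0" by (rule tendsto_mult_left_zero)
  have intb: "integrable M (\<lambda>x. g x * b x)"
    if [measurable]: "g \<in> borel_measurable M" and g: "integrable M (\<lambda>x. (cmod (g x))\<^sup>2)" for g
  proof (rule Bochner_Integration.integrable_bound)
    show "integrable M (\<lambda>x. \<bar>B\<bar> * cmod (g x))"
      using integrable_of_square[OF that] by simp
    show "AE x in M. norm (g x * b x) \<le> norm (\<bar>B\<bar> * cmod (g x))"
    proof (rule AE_I2)
      fix x assume "x \<in> space M"
      then show "norm (g x * b x) \<le> norm (\<bar>B\<bar> * cmod (g x))"
        using b[of x] mult_left_mono[of "cmod (b x)" "\<bar>B\<bar>" "cmod (g x)"]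
        by (simp add: norm_mult mult.commute)
    qed
  qed measurable
  have "norm ((\<integral>x. u n x * b x \<partial>M) - (\<integral>x. f x * b x \<partial>M)) \<le> (\<integral>x. h n x \<partial>M) * \<bar>B\<bar>" for n
  proof -
    have "(\<integral>x. u n x * b x \<partial>M) - (\<integral>x. f x * b x \<partial>M) = (\<integral>x. u n x * b x - f x * b x \<partial>M)"
      using intb u f by simp
    also have "norm \<dots> \<le> (\<integral>x. norm (u n x * b x - f x * b x) \<partial>M)" by (rule integral_norm_bound)
    also have "\<dots> \<le> (\<integral>x. h n x * \<bar>B\<bar> \<partial>M)"
    proof (rule integral_mono)
      show "integrable M (\<lambda>x. norm (u n x * b x - f x * b x))" using intb u f by simp
      show "integrable M (\<lambda>x. h n x * \<bar>B\<bar>)" using inth by simp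
      fix x assume "x \<in> space M"
      then have "h n x * cmod (b x) \<le> h n x * \<bar>B\<bar>"
        using b[of x] by (intro mult_left_mono) (auto simp: h_def)
      then show "norm (u n x * b x - f x * b x) \<le> h n x * \<bar>B\<bar>"
        by (simp add: h_def norm_mult flip: left_diff_distrib)
    qed
    finally show ?thesis by simp
  qed
  then have "(\<lambda>n. (\<integral>x. u n x * b x \<partial>M) - (\<integral>x. f x * b x \<partial>M)) \<longlonglongrightarrow> 0"
    by (intro Lim_null_comparison[OF _ lim0] always_eventually allI)
  then show ?thesis by (simp add: LIM_zero_iff)
qed


section \<open>Fourier coefficients of boundary values\<close>

definition taylor_coeff :: "(complex \<Rightarrow> complex) \<Rightarrow> nat \<Rightarrow> complex" where
  "taylor_coeff F n = (deriv ^^ n) F 0 / fact n"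

lemma taylor_coeff_sums:
  assumes "F holomorphic_on ball 0 1" "cmod w < 1"
  shows "(\<lambda>n. taylor_coeff F n * w ^ n) sums F w"
  using holomorphic_power_series[OF assms(1), of w] assms(2) by (simp add: taylor_coeff_def)

lemma continuous_on_dilation:
  assumes "F holomorphic_on ball 0 1" "0 \<le> r" "r < 1"
  shows "continuous_on (sphere 0 1) (\<lambda>z. F (of_real r * z))"
  by (rule continuous_on_compose2[OF holomorphic_on_imp_continuous_on[OF assms(1)]])
    (use assms in \<open>auto intro!: continuous_intros simp: norm_mult\<close>)

lemma integrable_square_dilation:
  assumes "F holomorphic_on ball 0 1" "0 \<le> r" "r < 1"
  shows "integrable circle_measure (\<lambda>z. (cmod (F (of_real r * z)))\<^sup>2)"
proof -
  have "integrable circle_measure (\<lambda>z. complex_of_real ((cmod (F (of_real r * z)))\<^sup>2))"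
    by (intro integrable_continuous_circle continuous_intros continuous_on_dilation[OF assms])
  then show ?thesis by (simp only: complex_of_real_integrable_eq)
qed

text \<open>On a circle of radius below 1 the Taylor series converges absolutely and uniformly, so
  it may be integrated termwise against a bounded function.\<close>

lemma sums_integral_dilation:
  assumes F: "F holomorphic_on ball 0 1" and r: "0 \<le> r" "r < 1"
    and b [measurable]: "b \<in> borel_measurable circle_measure"
    and B: "\<And>z. cmod z = 1 \<Longrightarrow> cmod (b z) \<le> B"
  shows "(\<lambda>n. taylor_coeff F n * of_real r ^ n * (\<integral>z. z ^ n * b z \<partial>circle_measure)) sums
    (\<integral>z. F (of_real r * z) * b z \<partial>circle_measure)"
proof -
  define g where "g n z = taylor_coeff F n * of_real r ^ n * (z ^ n * b z)" for n z
  have [measurable]: "(\<lambda>z. z ^ n) \<in> borel_measurable circle_measure" for n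
    by (intro borel_measurable_circleI continuous_intros)
  \<comment> \<open>The midpoint between \<open>r\<close> and 1 still lies in the disk; convergence
    there gives absolute convergence at \<open>r\<close>.\<close>
  have "(1 + r) / 2 < 1" "r < (1 + r) / 2" using r by auto
  have summ: "summable (\<lambda>n. cmod (taylor_coeff F n) * r ^ n)"
  proof -
    have "summable (\<lambda>n. taylor_coeff F n * of_real ((1 + r) / 2) ^ n)"
      by (rule sums_summable[OF taylor_coeff_sums[OF F]]) (use r in \<open>simp only: norm_of_real, simp\<close>)
    from powser_insidea[OF this, of "of_real r"] show ?thesis
      using r by (simp add: norm_mult norm_power del: of_real_divide of_real_add)
  qed
  have bound: "norm (g n z) \<le> cmod (taylor_coeff F n) * r ^ n * B" if "cmod z = 1" for n z
    using B[OF that] that r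
    by (auto simp: g_def norm_mult norm_power intro!: mult_left_mono mult_nonneg_nonneg)
  have int: "integrable circle_measure (g n)" for n
    by (rule circle.integrable_const_bound[of _ "cmod (taylor_coeff F n) * r ^ n * B"])
      (use bound in \<open>auto simp: g_def[abs_def] intro!: AE_circleI\<close>)
  have summB: "summable (\<lambda>n. cmod (taylor_coeff F n) * r ^ n * B)"
    using summ by (rule summable_mult2)
  have "(\<lambda>n. \<integral>z. g n z \<partial>circle_measure) sums (\<integral>z. (\<Sum>n. g n z) \<partial>circle_measure)"
  proof (rule sums_integral[OF int])
    show "AE z in circle_measure. summable (\<lambda>n. norm (g n z))"
      by (intro AE_circleI summable_comparison_test'[OF summB]) (use bound in simp)
    have "(\<integral>z. norm (g n z) \<partial>circle_measure) \<le> cmod (taylor_coeff F n) * r ^ n * B" for n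
    proof -
      have "(\<integral>z. norm (g n z) \<partial>circle_measure) \<le>
          (\<integral>z. cmod (taylor_coeff F n) * r ^ n * B \<partial>circle_measure)"
        using bound int by (intro integral_mono) auto
      then show ?thesis by simp
    qed
    then show "summable (\<lambda>n. \<integral>z. norm (g n z) \<partial>circle_measure)"
      by (intro summable_comparison_test'[OF summB]) simp
  qed
  moreover have "(\<Sum>n. g n z) = F (of_real r * z) * b z" if "cmod z = 1" for z
  proof -
    have "(\<lambda>n. taylor_coeff F n * (of_real r * z) ^ n) sums F (of_real r * z)"
      by (rule taylor_coeff_sums[OF F]) (use r that in \<open>simp add: norm_mult\<close>)
    from sums_mult2[OF this, of "b z"] show ?thesis
      by (intro sums_unique[symmetric]) (simp add: g_def power_mult_distrib mult.assoc)
  qed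
  then have "(\<integral>z. (\<Sum>n. g n z) \<partial>circle_measure) = (\<integral>z. F (of_real r * z) * b z \<partial>circle_measure)"
    by (intro Bochner_Integration.integral_cong) auto
  ultimately show ?thesis by (simp add: g_def)
qed

lemma integral_dilation_cnj_power:
  assumes "F holomorphic_on ball 0 1" "0 \<le> r" "r < 1"
  shows "(\<integral>z. F (of_real r * z) * cnj z ^ k \<partial>circle_measure) = taylor_coeff F k * of_real r ^ k"
proof -
  have "(\<lambda>n. if n = k then taylor_coeff F n * of_real r ^ n else 0) sums
      (\<integral>z. F (of_real r * z) * cnj z ^ k \<partial>circle_measure)"
    using sums_integral_dilation[OF assms, of "\<lambda>z. cnj z ^ k" 1]
    by (simp add: integral_circle_monomial norm_power borel_measurable_circleI continuous_intros
        if_distrib cong: if_cong)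
  from sums_unique2[OF this sums_single[of k "\<lambda>n. taylor_coeff F n * of_real r ^ n"]]
  show ?thesis .
qed

lemma integral_dilation_power:
  assumes "F holomorphic_on ball 0 1" "0 \<le> r" "r < 1" "k > 0"
  shows "(\<integral>z. F (of_real r * z) * z ^ k \<partial>circle_measure) = 0"
proof -
  have "(\<lambda>n. taylor_coeff F n * of_real r ^ n * (\<integral>z. z ^ (n + k) \<partial>circle_measure)) sums
      (\<integral>z. F (of_real r * z) * z ^ k \<partial>circle_measure)"
    using sums_integral_dilation[OF assms(1-3), of "\<lambda>z. z ^ k" 1]
    by (simp add: power_add norm_power borel_measurable_circleI continuous_intros)
  then have "(\<lambda>n. 0) sums (\<integral>z. F (of_real r * z) * z ^ k \<partial>circle_measure)"
    using assms(4) by (simp add: integral_circle_power)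
  from sums_unique2[OF this sums_zero] show ?thesis .
qed

text \<open>Pairs a Hardy function with a concrete representative of its boundary class, so that
  integrals can be computed before passing to the quotient \<open>ltwo\<close>.\<close>

definition boundary_function :: "(complex \<Rightarrow> complex) \<Rightarrow> (complex \<Rightarrow> complex) \<Rightarrow> bool" where
  "boundary_function F f \<longleftrightarrow> F \<in> hardy_functions \<and> square_integrable f \<and>
    (AE z in circle_measure. ((\<lambda>r. F (of_real r * z)) \<longlongrightarrow> f z) (at_left 1))"

text \<open>The uniform bound on the square means upgrades convergence almost everywhere to
  convergence of integrals against bounded functions. The radii are taken along a sequence because
  the limit theorem behind it is sequential.\<close>

lemma boundary_integral_tendsto:
  assumes F: "boundary_function F f"
    and b [measurable]: "b \<in> borel_measurable circle_measure"
    and B: "\<And>z. cmod z = 1 \<Longrightarrow> cmod (b z) \<le> B"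
  shows "(\<lambda>n. \<integral>z. F (of_real (1 - 1 / real (Suc n)) * z) * b z \<partial>circle_measure)
    \<longlonglongrightarrow> (\<integral>z. f z * b z \<partial>circle_measure)"
proof -
  define r where "r n = 1 - 1 / real (Suc n)" for n
  have r: "0 \<le> r n" "r n < 1" for n by (auto simp: r_def field_simps)
  have holF: "F holomorphic_on ball 0 1" using F by (simp add: boundary_function_def hardy_functions_def)
  have "filterlim r (at_left 1) sequentially"
  proof -
    have "r \<longlonglongrightarrow> 1 - 0" unfolding r_def
      by (intro tendsto_diff tendsto_const LIMSEQ_Suc[OF lim_const_over_n[of 1, simplified]])
    then show ?thesis using r less_imp_neq[OF r(2)] by (simp add: filterlim_at)
  qed
  then have lim: "(\<lambda>n. F (of_real (r n) * z)) \<longlonglongrightarrow> f z"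
    if "((\<lambda>r. F (of_real r * z)) \<longlongrightarrow> f z) (at_left 1)" for z
    using filterlim_compose[OF that] by blast
  have cont: "continuous_on (sphere 0 1) (\<lambda>z. F (of_real (r n) * z))" for n
    by (rule continuous_on_dilation[OF holF r])
  have "bdd_above ((\<lambda>r. \<integral>z. (cmod (F (of_real r * z)))\<^sup>2 \<partial>circle_measure) ` {0..<1})"
    using F by (simp add: boundary_function_def hardy_functions_def)
  then obtain C where "\<forall>x\<in>(\<lambda>r. \<integral>z. (cmod (F (of_real r * z)))\<^sup>2 \<partial>circle_measure) ` {0..<1}. x \<le> C"
    unfolding bdd_above_def by blast
  then have C: "(\<integral>z. (cmod (F (of_real r * z)))\<^sup>2 \<partial>circle_measure) \<le> C" if "0 \<le> r" "r < 1" for r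
    using that by simp
  have meas [measurable]: "(\<lambda>z. F (of_real (r n) * z)) \<in> borel_measurable circle_measure" for n
    by (rule borel_measurable_circleI[OF cont])
  have "(\<lambda>n. \<integral>z. F (of_real (r n) * z) * b z \<partial>circle_measure) \<longlonglongrightarrow> (\<integral>z. f z * b z \<partial>circle_measure)"
  proof (rule circle.bounded_square_integrals_tendsto[where C = C and B = B])
    show "integrable circle_measure (\<lambda>z. (cmod (F (of_real (r n) * z)))\<^sup>2)" for n
      by (rule integrable_square_dilation[OF holF r])
    show "AE z in circle_measure. (\<lambda>n. F (of_real (r n) * z)) \<longlonglongrightarrow> f z"
      using F lim by (auto simp: boundary_function_def elim: eventually_mono)
  qed (use F C r B in \<open>auto simp: boundary_function_def square_integrable_def\<close>)
  then show ?thesis by (simp add: r_def)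
qed

text \<open>The Fourier coefficients of negative index vanish for each dilation and therefore in the
  limit.\<close>

lemma boundary_integral_power:
  assumes "boundary_function F f" "k > 0"
  shows "(\<integral>z. f z * z ^ k \<partial>circle_measure) = 0"
proof -
  have "F holomorphic_on ball 0 1"
    using assms by (simp add: boundary_function_def hardy_functions_def)
  then have "(\<integral>z. F (of_real (1 - 1 / real (Suc n)) * z) * z ^ k \<partial>circle_measure) = 0" for n
    using assms(2) by (intro integral_dilation_power) (auto simp: field_simps)
  moreover have "(\<lambda>n. \<integral>z. F (of_real (1 - 1 / real (Suc n)) * z) * z ^ k \<partial>circle_measure)
      \<longlonglongrightarrow> (\<integral>z. f z * z ^ k \<partial>circle_measure)"
    by (rule boundary_integral_tendsto[OF assms(1), where B = 1])
      (auto simp: norm_power intro!: borel_measurable_circleI continuous_intros)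
  ultimately show ?thesis using LIMSEQ_unique[OF _ tendsto_const] by simp
qed

text \<open>Through this identity orthogonality relations on the circle become equations between
  Taylor coefficients in the disk.\<close>

lemma boundary_integral_cnj_power:
  assumes "boundary_function F f"
  shows "(\<integral>z. f z * cnj z ^ k \<partial>circle_measure) = taylor_coeff F k"
proof -
  have F: "F holomorphic_on ball 0 1"
    using assms by (simp add: boundary_function_def hardy_functions_def)
  have "(\<integral>z. F (of_real (1 - 1 / real (Suc n)) * z) * cnj z ^ k \<partial>circle_measure) =
      taylor_coeff F k * of_real (1 - 1 / real (Suc n)) ^ k" for n
    by (intro integral_dilation_cnj_power F) (auto simp: field_simps)
  moreover have "(\<lambda>n. \<integral>z. F (of_real (1 - 1 / real (Suc n)) * z) * cnj z ^ k \<partial>circle_measure)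
      \<longlonglongrightarrow> (\<integral>z. f z * cnj z ^ k \<partial>circle_measure)"
    by (rule boundary_integral_tendsto[OF assms(1), where B = 1])
      (auto simp: norm_power intro!: borel_measurable_circleI continuous_intros)
  moreover have "(\<lambda>n. taylor_coeff F k * of_real (1 - 1 / real (Suc n)) ^ k)
      \<longlonglongrightarrow> taylor_coeff F k * of_real (1 - 0) ^ k"
    by (intro tendsto_intros LIMSEQ_Suc[OF lim_const_over_n[of 1, simplified]])
  ultimately show ?thesis using LIMSEQ_unique by fastforce
qed

section \<open>The model space of a Blaschke product of degree three\<close>

text \<open>Source of all concrete members of the Hardy space: a function continuous up to the
  circle has its own values as radial limits.\<close>

lemma continuous_boundary_function:
  assumes cont: "continuous_on (cball 0 1) F" and hol: "F holomorphic_on ball 0 1"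
  shows "boundary_function F F"
proof -
  have "compact (F ` cball 0 1)" by (rule compact_continuous_image[OF cont compact_cball])
  then obtain K where "\<forall>w\<in>F ` cball 0 1. cmod w \<le> K"
    using compact_imp_bounded bounded_iff by metis
  then have K: "cmod (F w) \<le> K" if "cmod w \<le> 1" for w using that by simp
  have [measurable]: "F \<in> borel_measurable circle_measure"
    by (intro borel_measurable_circleI continuous_on_subset[OF cont]) auto
  have "integrable circle_measure (\<lambda>z. (cmod (F z))\<^sup>2)"
    by (intro circle.integrable_const_bound[of _ "K\<^sup>2"] AE_circleI) (auto intro!: power_mono K)
  then have sq: "square_integrable F" by (simp add: square_integrable_def)
  have "(\<integral>z. (cmod (F (of_real r * z)))\<^sup>2 \<partial>circle_measure) \<le> K\<^sup>2" if r: "0 \<le> r" "r < 1" for r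
  proof -
    have [measurable]: "(\<lambda>z. F (of_real r * z)) \<in> borel_measurable circle_measure"
      by (intro borel_measurable_circleI continuous_on_dilation[OF hol r])
    have le: "(cmod (F (of_real r * z)))\<^sup>2 \<le> K\<^sup>2" if "cmod z = 1" for z
      using that r by (intro power_mono K) (auto simp: norm_mult)
    then have "integrable circle_measure (\<lambda>z. (cmod (F (of_real r * z)))\<^sup>2)"
      by (intro circle.integrable_const_bound[of _ "K\<^sup>2"] AE_circleI) auto
    then have "(\<integral>z. (cmod (F (of_real r * z)))\<^sup>2 \<partial>circle_measure) \<le> (\<integral>z. K\<^sup>2 \<partial>circle_measure)"
      using le by (intro integral_mono) auto
    then show ?thesis by simp
  qed
  then have "F \<in> hardy_functions"
    using hol by (auto simp: hardy_functions_def intro!: bdd_aboveI[of _ "K\<^sup>2"])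
  moreover have "AE z in circle_measure. ((\<lambda>r. F (of_real r * z)) \<longlongrightarrow> F z) (at_left 1)"
  proof (rule AE_circleI)
    fix z :: complex assume z: "cmod z = 1"
    have "((\<lambda>r. of_real r * z) \<longlongrightarrow> of_real 1 * z) (at_left 1)" by (intro tendsto_intros)
    moreover have "\<forall>\<^sub>F r in at_left 1. of_real r * z \<in> cball 0 1"
      using eventually_at_left_real[OF zero_less_one] by eventually_elim (auto simp: norm_mult z)
    ultimately show "((\<lambda>r. F (of_real r * z)) \<longlongrightarrow> F z) (at_left 1)"
      using continuous_on_tendsto_compose[OF cont, of "\<lambda>r. of_real r * z" z] z by simp
  qed
  ultimately show ?thesis using sq by (simp add: boundary_function_def)
qed

lemma hardy_functions_mult_bounded:
  assumes F: "F \<in> hardy_functions" and G: "G holomorphic_on ball 0 1"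
    and K: "\<And>z. cmod z < 1 \<Longrightarrow> cmod (G z) \<le> K"
  shows "(\<lambda>z. F z * G z) \<in> hardy_functions"
proof -
  have hol: "F holomorphic_on ball 0 1" using F by (simp add: hardy_functions_def)
  have holFG: "(\<lambda>z. F z * G z) holomorphic_on ball 0 1" by (intro holomorphic_intros hol G)
  obtain C where "\<forall>x\<in>(\<lambda>r. \<integral>z. (cmod (F (of_real r * z)))\<^sup>2 \<partial>circle_measure) ` {0..<1}. x \<le> C"
    using F by (auto simp only: hardy_functions_def bdd_above_def mem_Collect_eq)
  then have C: "(\<integral>z. (cmod (F (of_real r * z)))\<^sup>2 \<partial>circle_measure) \<le> C" if "0 \<le> r" "r < 1" for r
    using that by simp
  have "(\<integral>z. (cmod (F (of_real r * z) * G (of_real r * z)))\<^sup>2 \<partial>circle_measure) \<le> K\<^sup>2 * C"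
    if r: "0 \<le> r" "r < 1" for r
  proof -
    have "(\<integral>z. (cmod (F (of_real r * z) * G (of_real r * z)))\<^sup>2 \<partial>circle_measure) \<le>
        (\<integral>z. K\<^sup>2 * (cmod (F (of_real r * z)))\<^sup>2 \<partial>circle_measure)"
    proof (rule integral_mono)
      show "integrable circle_measure (\<lambda>z. (cmod (F (of_real r * z) * G (of_real r * z)))\<^sup>2)"
        by (rule integrable_square_dilation[OF holFG r])
      show "integrable circle_measure (\<lambda>z. K\<^sup>2 * (cmod (F (of_real r * z)))\<^sup>2)"
        by (intro integrable_mult_right integrable_square_dilation[OF hol r])
      fix z assume "z \<in> space circle_measure"
      then have "(cmod (G (of_real r * z)))\<^sup>2 \<le> K\<^sup>2"
        using r by (intro power_mono K) (auto simp: norm_mult)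
      then show "(cmod (F (of_real r * z) * G (of_real r * z)))\<^sup>2 \<le> K\<^sup>2 * (cmod (F (of_real r * z)))\<^sup>2"
        using mult_left_mono[of "(cmod (G (of_real r * z)))\<^sup>2" "K\<^sup>2" "(cmod (F (of_real r * z)))\<^sup>2"]
        by (simp add: norm_mult power_mult_distrib mult_ac)
    qed
    also have "\<dots> \<le> K\<^sup>2 * C" using C[OF r] by (simp add: mult_left_mono)
    finally show ?thesis .
  qed
  then show ?thesis
    using holFG by (auto simp: hardy_functions_def intro!: bdd_aboveI[of _ "K\<^sup>2 * C"])
qed

lemma square_integrable_mult_bounded:
  assumes f: "square_integrable f" and c [measurable]: "c \<in> borel_measurable circle_measure"
    and K: "\<And>z. cmod z = 1 \<Longrightarrow> cmod (c z) \<le> K"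
  shows "square_integrable (\<lambda>z. c z * f z)"
proof -
  have [measurable]: "f \<in> borel_measurable circle_measure" using f by (simp add: square_integrable_def)
  have "integrable circle_measure (\<lambda>z. (cmod (c z * f z))\<^sup>2)"
  proof (rule Bochner_Integration.integrable_bound)
    show "integrable circle_measure (\<lambda>z. K\<^sup>2 * (cmod (f z))\<^sup>2)"
      using f by (simp add: square_integrable_def)
    show "AE z in circle_measure. norm ((cmod (c z * f z))\<^sup>2) \<le> norm (K\<^sup>2 * (cmod (f z))\<^sup>2)"
    proof (rule AE_circleI)
      fix z :: complex assume "cmod z = 1"
      then have "(cmod (c z))\<^sup>2 \<le> K\<^sup>2" by (intro power_mono K) auto
      then show "norm ((cmod (c z * f z))\<^sup>2) \<le> norm (K\<^sup>2 * (cmod (f z))\<^sup>2)"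
        by (simp add: norm_mult power_mult_distrib mult_right_mono)
    qed
  qed measurable
  then show ?thesis by (simp add: square_integrable_def)
qed

lemma integrable_mult_bounded:
  assumes f: "square_integrable f" and c: "c \<in> borel_measurable circle_measure"
    and K: "\<And>z. cmod z = 1 \<Longrightarrow> cmod (c z) \<le> K"
  shows "integrable circle_measure (\<lambda>z. c z * f z)"
  using square_integrable_mult_bounded[OF assms] by (auto simp: square_integrable_def intro: circle.integrable_of_square)

section \<open>Representatives of classes in \<open>ltwo\<close>\<close>

lemma square_integrable_rep_ltwo: "square_integrable (rep_ltwo x)"
  using Quotient_rep_reflp[OF Quotient_ltwo] by blast

lemma abs_rep_ltwo: "abs_ltwo (rep_ltwo x) = x"
  by (rule Quotient_abs_rep[OF Quotient_ltwo])

lemma abs_ltwo_eqI: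
  assumes "square_integrable f" "square_integrable g" "AE z in circle_measure. f z = g z"
  shows "abs_ltwo f = abs_ltwo g"
  using assms by (intro Quotient_rel_abs[OF Quotient_ltwo]) simp

lemma rep_abs_ltwo:
  assumes "square_integrable f"
  shows "AE z in circle_measure. rep_ltwo (abs_ltwo f) z = f z"
  using Quotient_rep_abs[OF Quotient_ltwo, of f] assms by simp

lemma ltwo_cases:
  obtains f where "square_integrable f" "x = abs_ltwo f"
  using abs_rep_ltwo square_integrable_rep_ltwo by metis

lemma ltwo_inner_abs:
  assumes "square_integrable f" "square_integrable g"
  shows "ltwo_inner (abs_ltwo f) (abs_ltwo g) = (\<integral>z. f z * cnj (g z) \<partial>circle_measure)"
  using assms by (simp add: ltwo_inner.abs_eq)

lemma plus_abs_ltwo: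
  assumes "square_integrable f" "square_integrable g"
  shows "abs_ltwo f + abs_ltwo g = abs_ltwo (\<lambda>z. f z + g z)"
  using assms by (simp add: plus_ltwo.abs_eq)

lemma minus_abs_ltwo:
  assumes "square_integrable f" "square_integrable g"
  shows "abs_ltwo f - abs_ltwo g = abs_ltwo (\<lambda>z. f z - g z)"
  using assms by (simp add: minus_ltwo.abs_eq)

lemma scale_abs_ltwo:
  assumes "square_integrable f"
  shows "ltwo_scale c (abs_ltwo f) = abs_ltwo (\<lambda>z. c * f z)"
  using assms by (simp add: ltwo_scale.abs_eq)

lemma has_boundary_values_abs:
  assumes "square_integrable f"
  shows "has_boundary_values F (abs_ltwo f) \<longleftrightarrow>
    (AE z in circle_measure. ((\<lambda>r. F (of_real r * z)) \<longlongrightarrow> f z) (at_left 1))"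
  using assms by (simp add: has_boundary_values.abs_eq)

lemma hardy_space_cases:
  assumes "x \<in> hardy_space"
  obtains F f where "boundary_function F f" "x = abs_ltwo f"
proof -
  obtain f where f: "square_integrable f" "x = abs_ltwo f" by (rule ltwo_cases)
  moreover obtain F where "F \<in> hardy_functions" "has_boundary_values F x"
    using assms by (auto simp: hardy_space_def)
  ultimately show ?thesis
    using that[of F f] by (simp add: boundary_function_def has_boundary_values_abs)
qed

lemma boundary_function_hardy_space:
  "boundary_function F f \<Longrightarrow> abs_ltwo f \<in> hardy_space"
  by (auto simp: hardy_space_def boundary_function_def has_boundary_values_abs)

text \<open>The Blaschke product with zeros 0 and the two square roots of \<open>a\<close>, which
  may be imaginary; since \<open>a\<close> is real, their two factors combine to the quotient of
  \<open>z^2 - a\<close> by \<open>1 - a z^2\<close>.\<close>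

definition blaschke :: "real \<Rightarrow> complex \<Rightarrow> complex" where
  "blaschke a z = z * (z\<^sup>2 - of_real a) / (1 - of_real a * z\<^sup>2)"

text \<open>The classical form of the model space of a finite Blaschke product of degree n:
  polynomials of degree below n over the product of the denominators of its factors.\<close>

definition kernel_quotient :: "real \<Rightarrow> complex \<Rightarrow> complex \<Rightarrow> complex \<Rightarrow> complex \<Rightarrow> complex" where
  "kernel_quotient a b\<^sub>0 b\<^sub>1 b\<^sub>2 z = (b\<^sub>0 + b\<^sub>1 * z + b\<^sub>2 * z\<^sup>2) / (1 - of_real a * z\<^sup>2)"

context
  fixes a :: real
  assumes a: "\<bar>a\<bar> < 1"
begin

lemma denominator_bound:
  assumes "cmod z \<le> 1"
  shows "1 - \<bar>a\<bar> \<le> cmod (1 - of_real a * z\<^sup>2)"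
proof -
  have "cmod (of_real a * z\<^sup>2) \<le> \<bar>a\<bar> * 1"
    unfolding norm_mult norm_of_real norm_power
    by (intro mult_left_mono) (use assms in \<open>auto simp: power_le_one\<close>)
  then show ?thesis using norm_triangle_ineq2[of 1 "of_real a * z\<^sup>2"] by simp
qed

lemma denominator_nonzero: "cmod z \<le> 1 \<Longrightarrow> 1 - of_real a * z\<^sup>2 \<noteq> 0"
  using denominator_bound[of z] a by auto

lemma inverse_denominator_bound: "cmod z \<le> 1 \<Longrightarrow> cmod (1 / (1 - of_real a * z\<^sup>2)) \<le> 1 / (1 - \<bar>a\<bar>)"
  using denominator_bound[of z] a by (simp add: norm_divide frac_le)

lemma numerator_bound:
  assumes "cmod z = 1"
  shows "1 - \<bar>a\<bar> \<le> cmod (z\<^sup>2 - of_real a)"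
  using norm_triangle_ineq2[of "z\<^sup>2" "of_real a"] assms by (simp add: norm_power)

lemma numerator_nonzero: "cmod z = 1 \<Longrightarrow> z\<^sup>2 - of_real a \<noteq> 0"
  using numerator_bound[of z] a by auto

lemma holomorphic_blaschke: "blaschke a holomorphic_on ball 0 1"
  unfolding blaschke_def using denominator_nonzero by (intro holomorphic_intros) auto

lemma cnj_eq_inverse: "cmod z = 1 \<Longrightarrow> cnj z = 1 / z"
  by (metis complex_norm_square divide_self_if mult.commute mult_zero_left nonzero_mult_div_cancel_left norm_zero of_real_1 one_power2 zero_neq_one)

text \<open>Up to \<open>z^2\<close>, conjugation on the circle exchanges the two quadratic factors
  of \<open>blaschke a\<close>. Its modulus one there and the cancellation against kernel quotients
  both rest on this.\<close>

lemma cnj_denominator: "cmod z = 1 \<Longrightarrow> cnj (1 - of_real a * z\<^sup>2) = (z\<^sup>2 - of_real a) / z\<^sup>2"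
  using cnj_eq_inverse[of z] by (cases "z = 0") (simp_all add: diff_divide_distrib power_divide)

lemma inner_blaschke: "inner_function (blaschke a)"
  unfolding inner_function_def
proof (intro conjI holomorphic_blaschke)
  have "cmod (blaschke a z) \<le> 2 / (1 - \<bar>a\<bar>)" if "cmod z < 1" for z
  proof -
    have "cmod (z * (z\<^sup>2 - of_real a)) \<le> 1 * (1 + 1)"
      unfolding norm_mult using that a
      by (intro mult_mono order_trans[OF norm_triangle_ineq4] add_mono)
        (auto simp: norm_power power_le_one)
    then show ?thesis
      using denominator_bound[of z] that a unfolding blaschke_def norm_divide by (intro frac_le) auto
  qed
  then show "bounded (blaschke a ` ball 0 1)"
    unfolding bounded_iff by (intro exI[of _ "2 / (1 - \<bar>a\<bar>)"]) auto
  show "AE z in circle_measure. \<exists>w. cmod w = 1 \<and> ((\<lambda>r. blaschke a (of_real r * z)) \<longlongrightarrow> w) (at_left 1)"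
  proof (rule AE_circleI)
    fix z :: complex assume z: "cmod z = 1"
    have "((\<lambda>r. blaschke a (of_real r * z)) \<longlongrightarrow> blaschke a (of_real 1 * z)) (at_left 1)"
      unfolding blaschke_def using denominator_nonzero[of z] z by (intro tendsto_intros) auto
    moreover have "cmod (blaschke a z) = 1"
      using cnj_denominator[OF z] numerator_nonzero[OF z] z
      by (simp add: blaschke_def norm_divide norm_mult norm_power complex_mod_cnj[of "1 - _", symmetric]
          del: complex_mod_cnj complex_cnj_diff)
    ultimately show "\<exists>w. cmod w = 1 \<and> ((\<lambda>r. blaschke a (of_real r * z)) \<longlongrightarrow> w) (at_left 1)"
      by auto
  qed
qed

lemma blaschke_not_constant: "\<not> blaschke a constant_on ball 0 1"
proof
  assume "blaschke a constant_on ball 0 1"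
  then obtain c where c: "\<And>z. cmod z < 1 \<Longrightarrow> blaschke a z = c" by (auto simp: constant_on_def)
  have "c = 0" using c[of 0] by (simp add: blaschke_def)
  have "z\<^sup>2 = of_real a" if "z \<noteq> 0" "cmod z < 1" for z
    using c[of z] denominator_nonzero[of z] that \<open>c = 0\<close> by (simp add: blaschke_def)
  from this[of "1 / 2"] this[of "1 / 3"]
  have "of_real a = (1 / 4 :: complex)" "of_real a = (1 / 9 :: complex)"
    by (simp_all add: power2_eq_square)
  then show False by simp
qed

lemma kernel_quotient_boundary:
  "boundary_function (kernel_quotient a b\<^sub>0 b\<^sub>1 b\<^sub>2) (kernel_quotient a b\<^sub>0 b\<^sub>1 b\<^sub>2)"
proof (rule continuous_boundary_function)
  show "continuous_on (cball 0 1) (kernel_quotient a b\<^sub>0 b\<^sub>1 b\<^sub>2)"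
    unfolding kernel_quotient_def using denominator_nonzero by (intro continuous_intros) auto
  show "kernel_quotient a b\<^sub>0 b\<^sub>1 b\<^sub>2 holomorphic_on ball 0 1"
    unfolding kernel_quotient_def using denominator_nonzero by (intro holomorphic_intros) auto
qed

lemma square_integrable_kernel_quotient: "square_integrable (kernel_quotient a b\<^sub>0 b\<^sub>1 b\<^sub>2)"
  using kernel_quotient_boundary by (simp add: boundary_function_def)

text \<open>On the circle an element of \<open>\<Theta> H\<^sup>2\<close> is \<open>z (z\<^sup>2 - a) f\<close> with \<open>f\<close> in \<open>H\<^sup>2\<close>, and the factor
  \<open>z\<^sup>2 - a\<close> cancels the denominator of the conjugate of a kernel quotient.\<close>

lemma kernel_quotient_in_model_space: "abs_ltwo (kernel_quotient a b\<^sub>0 b\<^sub>1 b\<^sub>2) \<in> model_space (blaschke a)"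
  unfolding model_space_def
proof (intro CollectI conjI ballI boundary_function_hardy_space[OF kernel_quotient_boundary])
  fix x assume "x \<in> inner_multiples (blaschke a)"
  then obtain F where F: "F \<in> hardy_functions" "has_boundary_values (\<lambda>z. blaschke a z * F z) x"
    by (auto simp: inner_multiples_def)
  obtain g where g: "square_integrable g" "x = abs_ltwo g" by (rule ltwo_cases)
  \<comment> \<open>\<open>blaschke a z * F z\<close> is \<open>z * (z^2 - a) * F' z\<close> and has
    the radial limits \<open>g\<close>. The polynomial in front has no zero on the circle, so
    \<open>f\<close> gives the radial limits of \<open>F'\<close>.\<close>
  define F' where "F' z = F z * (1 / (1 - of_real a * z\<^sup>2))" for z
  define f where "f z = 1 / (z * (z\<^sup>2 - of_real a)) * g z" for z
  have "F' \<in> hardy_functions" unfolding F'_def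
    by (intro hardy_functions_mult_bounded[OF F(1), where K = "1 / (1 - \<bar>a\<bar>)"] inverse_denominator_bound)
      (use denominator_nonzero in \<open>auto intro!: holomorphic_intros\<close>)
  moreover have "square_integrable f" unfolding f_def
  proof (rule square_integrable_mult_bounded[OF g(1)])
    show "(\<lambda>z. 1 / (z * (z\<^sup>2 - of_real a))) \<in> borel_measurable circle_measure"
      using numerator_nonzero by (intro borel_measurable_circleI continuous_intros) auto
    show "cmod (1 / (z * (z\<^sup>2 - of_real a))) \<le> 1 / (1 - \<bar>a\<bar>)" if "cmod z = 1" for z
      using numerator_bound[OF that] that a by (simp add: norm_divide norm_mult frac_le)
  qed
  moreover have "AE z in circle_measure. ((\<lambda>r. F' (of_real r * z)) \<longlongrightarrow> f z) (at_left 1)"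
  proof -
    have "AE z in circle_measure. ((\<lambda>r. blaschke a (of_real r * z) * F (of_real r * z)) \<longlongrightarrow> g z) (at_left 1)"
      using F(2) g by (simp add: has_boundary_values_abs)
    moreover have "AE z in circle_measure. cmod z = 1" by (rule AE_circleI)
    ultimately show ?thesis
    proof eventually_elim
      case (elim z)
      let ?d = "\<lambda>r. of_real r * z * ((of_real r * z)\<^sup>2 - of_real a)"
      have d: "of_real 1 * z * ((of_real 1 * z)\<^sup>2 - of_real a) \<noteq> 0"
        using numerator_nonzero[OF elim(2)] elim(2) by auto
      have dlim: "(?d \<longlongrightarrow> of_real 1 * z * ((of_real 1 * z)\<^sup>2 - of_real a)) (at_left 1)"
        by (intro tendsto_intros)
      have "((\<lambda>r. 1 / ?d r * (blaschke a (of_real r * z) * F (of_real r * z))) \<longlongrightarrow> f z) (at_left 1)"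
        using tendsto_mult[OF tendsto_divide[OF tendsto_const[of 1] dlim d] elim(1)] by (simp add: f_def)
      moreover have "\<forall>\<^sub>F r in at_left 1. 1 / ?d r * (blaschke a (of_real r * z) * F (of_real r * z)) =
          F' (of_real r * z)"
        using tendsto_imp_eventually_ne[OF dlim d]
        by eventually_elim (auto simp: blaschke_def F'_def divide_simps)
      ultimately show ?case by (rule Lim_transform_eventually)
    qed
  qed
  ultimately have f: "boundary_function F' f" by (simp add: boundary_function_def)
  have int: "integrable circle_measure (\<lambda>z. f z * z ^ k)" for k
    using f integrable_mult_bounded[of f "\<lambda>z. z ^ k" 1]
    by (simp add: boundary_function_def norm_power borel_measurable_circleI continuous_intros mult.commute)
  \<comment> \<open>The factor \<open>z\<close> of \<open>blaschke a\<close> raises every power to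
    at least 1, which is exactly where the moments of \<open>f\<close> vanish.\<close>
  have "g z * cnj (kernel_quotient a b\<^sub>0 b\<^sub>1 b\<^sub>2 z) =
      cnj b\<^sub>0 * (f z * z ^ 3) + cnj b\<^sub>1 * (f z * z ^ 2) + cnj b\<^sub>2 * (f z * z ^ 1)" if z: "cmod z = 1" for z
  proof -
    have "z \<noteq> 0" "z\<^sup>2 - of_real a \<noteq> 0" using z numerator_nonzero[OF z] by auto
    have "cnj (kernel_quotient a b\<^sub>0 b\<^sub>1 b\<^sub>2 z) =
        (cnj b\<^sub>0 + cnj b\<^sub>1 * cnj z + cnj b\<^sub>2 * (cnj z)\<^sup>2) / cnj (1 - of_real a * z\<^sup>2)"
      by (simp add: kernel_quotient_def)
    also have "\<dots> = (cnj b\<^sub>0 + cnj b\<^sub>1 / z + cnj b\<^sub>2 / z\<^sup>2) * z\<^sup>2 / (z\<^sup>2 - of_real a)"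
      unfolding cnj_denominator[OF z] cnj_eq_inverse[OF z] by (simp add: power_divide)
    also have "\<dots> = (cnj b\<^sub>0 * z\<^sup>2 + cnj b\<^sub>1 * z + cnj b\<^sub>2) / (z\<^sup>2 - of_real a)"
      using \<open>z \<noteq> 0\<close> by (simp add: distrib_right power2_eq_square)
    finally have "g z * cnj (kernel_quotient a b\<^sub>0 b\<^sub>1 b\<^sub>2 z) =
        f z * z * (z\<^sup>2 - of_real a) * ((cnj b\<^sub>0 * z\<^sup>2 + cnj b\<^sub>1 * z + cnj b\<^sub>2) / (z\<^sup>2 - of_real a))"
      using \<open>z \<noteq> 0\<close> \<open>z\<^sup>2 - of_real a \<noteq> 0\<close> by (simp add: f_def)
    also have "\<dots> = f z * z * (cnj b\<^sub>0 * z\<^sup>2 + cnj b\<^sub>1 * z + cnj b\<^sub>2)"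
      using \<open>z\<^sup>2 - of_real a \<noteq> 0\<close> by simp
    finally show ?thesis by (simp add: algebra_simps power2_eq_square power3_eq_cube)
  qed
  then have "(\<integral>z. g z * cnj (kernel_quotient a b\<^sub>0 b\<^sub>1 b\<^sub>2 z) \<partial>circle_measure) = (\<integral>z. cnj b\<^sub>0 * (f z * z ^ 3) +
      cnj b\<^sub>1 * (f z * z ^ 2) + cnj b\<^sub>2 * (f z * z ^ 1) \<partial>circle_measure)"
    by (intro Bochner_Integration.integral_cong) auto
  also have "\<dots> = 0"
    using int[of 3] int[of 2] int[of 1] boundary_integral_power[OF f, of 3]
      boundary_integral_power[OF f, of 2] boundary_integral_power[OF f, of 1] by simp
  finally have "cnj (\<integral>z. g z * cnj (kernel_quotient a b\<^sub>0 b\<^sub>1 b\<^sub>2 z) \<partial>circle_measure) = 0" by simp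
  then have "(\<integral>z. kernel_quotient a b\<^sub>0 b\<^sub>1 b\<^sub>2 z * cnj (g z) \<partial>circle_measure) = 0"
    by (simp add: integral_circle_cnj[symmetric] mult.commute)
  then show "ltwo_inner (abs_ltwo (kernel_quotient a b\<^sub>0 b\<^sub>1 b\<^sub>2)) x = 0"
    using g square_integrable_kernel_quotient by (simp add: ltwo_inner_abs)
qed

text \<open>Orthogonality to \<open>\<Theta> (1 - a z\<^sup>2) z\<^sup>k\<close> is a linear recursion for the Taylor coefficients.\<close>

lemma model_space_kernel_quotient:
  assumes "x \<in> model_space (blaschke a)"
  obtains b\<^sub>0 b\<^sub>1 b\<^sub>2 where "x = abs_ltwo (kernel_quotient a b\<^sub>0 b\<^sub>1 b\<^sub>2)"
proof -
  obtain F f where f: "boundary_function F f" and x: "x = abs_ltwo f"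
    using assms by (auto simp: model_space_def elim: hardy_space_cases)
  have sq: "square_integrable f" and hol: "F holomorphic_on ball 0 1"
    and lim: "AE z in circle_measure. ((\<lambda>r. F (of_real r * z)) \<longlongrightarrow> f z) (at_left 1)"
    using f by (auto simp: boundary_function_def hardy_functions_def)
  define T where "T = taylor_coeff F"
  have rec: "T (k + 3) = of_real a * T (k + 1)" for k
  proof -
    \<comment> \<open>The factor \<open>1 - a z^2\<close> clears the denominator of
      \<open>blaschke a\<close>, so the product is the binomial \<open>g\<close> and each relation
      involves only two coefficients.\<close>
    define G where "G z = (1 - of_real a * z\<^sup>2) * z ^ k" for z :: complex
    define g where "g z = z ^ (k + 3) - of_real a * z ^ (k + 1)" for z :: complex
    have G: "boundary_function G G" and g: "boundary_function g g"
      unfolding G_def g_def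
      by (rule continuous_boundary_function; intro continuous_intros holomorphic_intros)+
    have prod: "blaschke a z * G z = g z" if "cmod z < 1" for z
    proof -
      have "blaschke a z * G z = z * (z\<^sup>2 - of_real a) * z ^ k"
        using denominator_nonzero[of z] that by (simp add: blaschke_def G_def)
      then show ?thesis
        by (simp add: g_def power_add power2_eq_square power3_eq_cube algebra_simps)
    qed
    have "AE z in circle_measure. ((\<lambda>r. blaschke a (of_real r * z) * G (of_real r * z)) \<longlongrightarrow> g z) (at_left 1)"
    proof -
      have "AE z in circle_measure. ((\<lambda>r. g (of_real r * z)) \<longlongrightarrow> g z) (at_left 1)"
        using g by (simp add: boundary_function_def)
      moreover have "AE z in circle_measure. cmod z = 1" by (rule AE_circleI)
      ultimately show ?thesis
      proof eventually_elim
        case (elim z)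
        have "\<forall>\<^sub>F r in at_left 1. g (of_real r * z) = blaschke a (of_real r * z) * G (of_real r * z)"
          using eventually_at_left_real[OF zero_less_one]
          by eventually_elim (use prod elim in \<open>simp add: norm_mult\<close>)
        then show ?case using elim(1) by (rule Lim_transform_eventually[rotated])
      qed
    qed
    then have "abs_ltwo g \<in> inner_multiples (blaschke a)"
      using G g by (auto simp: inner_multiples_def boundary_function_def has_boundary_values_abs)
    then have "ltwo_inner x (abs_ltwo g) = 0" using assms by (simp add: model_space_def)
    then have "0 = (\<integral>z. f z * cnj (g z) \<partial>circle_measure)"
      using g sq by (simp add: x ltwo_inner_abs boundary_function_def)
    also have "\<dots> = (\<integral>z. f z * cnj z ^ (k + 3) - of_real a * (f z * cnj z ^ (k + 1)) \<partial>circle_measure)"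
      by (simp add: g_def algebra_simps)
    also have "\<dots> = T (k + 3) - of_real a * T (k + 1)"
    proof -
      have "integrable circle_measure (\<lambda>z. f z * cnj z ^ j)" for j
        using integrable_mult_bounded[OF sq, of "\<lambda>z. cnj z ^ j" 1]
        by (simp add: norm_power borel_measurable_circleI continuous_intros mult.commute)
      then show ?thesis
        using boundary_integral_cnj_power[OF f] by (simp add: T_def del: power_Suc)
    qed
    finally show ?thesis by simp
  qed
  \<comment> \<open>The numerator is \<open>F\<close> times \<open>1 - a z^2\<close>. The recursion
    kills its coefficients from degree 3 on; the coefficient of degree 2 is not reached and keeps
    the correction \<open>- a * T 0\<close>.\<close>
  define R where "R = kernel_quotient a (T 0) (T 1) (T 2 - of_real a * T 0)"
  have FR: "F w = R w" if w: "cmod w < 1" for w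
  proof -
    have s: "(\<lambda>n. T n * w ^ n) sums F w" unfolding T_def by (rule taylor_coeff_sums[OF hol w])
    have "(\<lambda>n. T (n + 3) * w ^ (n + 3)) sums (F w - (T 0 + T 1 * w + T 2 * w\<^sup>2))"
      using sums_split_initial_segment[OF s, of 3] by (simp add: eval_nat_numeral)
    moreover have "(\<lambda>n. T (n + 1) * w ^ (n + 1)) sums (F w - T 0)"
      using sums_split_initial_segment[OF s, of 1] by simp
    from sums_mult[OF this, of "of_real a * w\<^sup>2"]
    have "(\<lambda>n. T (n + 3) * w ^ (n + 3)) sums (of_real a * w\<^sup>2 * (F w - T 0))"
      unfolding rec by (simp add: power_add power2_eq_square power3_eq_cube mult_ac)
    ultimately have "F w - (T 0 + T 1 * w + T 2 * w\<^sup>2) = of_real a * w\<^sup>2 * (F w - T 0)"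
      by (rule sums_unique2)
    then have "F w * (1 - of_real a * w\<^sup>2) = T 0 + T 1 * w + (T 2 - of_real a * T 0) * w\<^sup>2"
      by (simp add: algebra_simps)
    then show ?thesis
      using denominator_nonzero[of w] w by (simp add: R_def kernel_quotient_def eq_divide_eq)
  qed
  \<comment> \<open>\<open>F\<close> and \<open>R\<close> are known to agree only inside the disk;
    uniqueness of radial limits carries the equality to almost every point of the circle.\<close>
  have "AE z in circle_measure. ((\<lambda>r. R (of_real r * z)) \<longlongrightarrow> R z) (at_left 1)"
    using kernel_quotient_boundary by (simp add: R_def boundary_function_def)
  moreover have "AE z in circle_measure. cmod z = 1" by (rule AE_circleI)
  ultimately have "AE z in circle_measure. f z = R z"
    using lim
  proof eventually_elim
    case (elim z)
    have "\<forall>\<^sub>F r in at_left 1. F (of_real r * z) = R (of_real r * z)"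
      using eventually_at_left_real[OF zero_less_one] by eventually_elim (use FR elim in \<open>simp add: norm_mult\<close>)
    from Lim_transform_eventually[OF elim(3) this] elim(1) show ?case
      by (rule tendsto_unique[OF trivial_limit_at_left_real])
  qed
  then have "x = abs_ltwo R"
    unfolding x R_def by (intro abs_ltwo_eqI sq square_integrable_kernel_quotient)
  then show ?thesis using that unfolding R_def by blast
qed

end

section \<open>Compressions in an orthonormal frame\<close>

definition moment :: "(complex \<Rightarrow> complex) \<Rightarrow> nat \<Rightarrow> nat \<Rightarrow> complex" where
  "moment \<mu> m n = (\<integral>z. \<mu> z * (z ^ m * cnj z ^ n) \<partial>circle_measure)"

definition model_frame :: "real \<Rightarrow> real \<Rightarrow> 3 \<Rightarrow> complex \<Rightarrow> complex" where
  "model_frame p q j z =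
    (if j = 1 then of_real q * (1 + z\<^sup>2)
     else if j = 2 then \<i> * of_real p * (1 - z\<^sup>2)
     else 2 * of_real p * of_real q * z) / (1 - of_real (p\<^sup>2 - q\<^sup>2) * z\<^sup>2)"

text \<open>At \<open>z = cis t\<close> the values are the real numbers \<open>2 q cos t\<close>, \<open>2 p sin t\<close> and \<open>2 p q\<close>.
  The conjugation of the model space fixes the frame, which is why the compressions are
  complex symmetric in it.\<close>

definition frame_factor :: "real \<Rightarrow> real \<Rightarrow> 3 \<Rightarrow> complex \<Rightarrow> complex" where
  "frame_factor p q j z =
    (if j = 1 then of_real q * (z + cnj z)
     else if j = 2 then \<i> * of_real p * (cnj z - z)
     else 2 * of_real p * of_real q)"

lemma moment_conjugate:
  assumes "\<And>z. cmod z = 1 \<Longrightarrow> cnj (\<mu> z) = \<mu> z"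
  shows "moment \<mu> m n = cnj (moment \<mu> n m)"
  unfolding moment_def integral_circle_cnj[symmetric]
  by (rule Bochner_Integration.integral_cong) (simp_all add: assms mult.commute)

text \<open>Arranged so that the coefficients are the moments: \<open>c\<^sub>k\<close> is the
  moment with indices \<open>k 0\<close> and \<open>d\<^sub>k\<close> the one with indices
  \<open>0 k\<close>.\<close>

definition laurent_symbol :: "complex \<Rightarrow> complex \<Rightarrow> complex \<Rightarrow> complex \<Rightarrow> complex \<Rightarrow> complex \<Rightarrow> complex" where
  "laurent_symbol c\<^sub>0 c\<^sub>1 d\<^sub>1 c\<^sub>2 d\<^sub>2 z = c\<^sub>0 + c\<^sub>1 * cnj z + d\<^sub>1 * z + c\<^sub>2 * (cnj z)\<^sup>2 + d\<^sub>2 * z\<^sup>2"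

lemma moment_laurent_symbol:
  "moment (laurent_symbol c\<^sub>0 c\<^sub>1 d\<^sub>1 c\<^sub>2 d\<^sub>2) m n =
    (if m = n then c\<^sub>0 else 0) + (if m = n + 1 then c\<^sub>1 else 0) + (if m + 1 = n then d\<^sub>1 else 0)
    + (if m = n + 2 then c\<^sub>2 else 0) + (if m + 2 = n then d\<^sub>2 else 0)"
proof -
  have int: "integrable circle_measure (\<lambda>z. z ^ i * cnj z ^ j)" for i j
    by (intro integrable_continuous_circle continuous_intros)
  have "laurent_symbol c\<^sub>0 c\<^sub>1 d\<^sub>1 c\<^sub>2 d\<^sub>2 z * (z ^ m * cnj z ^ n) =
      c\<^sub>0 * (z ^ m * cnj z ^ n) + c\<^sub>1 * (z ^ m * cnj z ^ (n + 1)) + d\<^sub>1 * (z ^ (m + 1) * cnj z ^ n)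
      + c\<^sub>2 * (z ^ m * cnj z ^ (n + 2)) + d\<^sub>2 * (z ^ (m + 2) * cnj z ^ n)" for z
    by (simp add: laurent_symbol_def power_add power2_eq_square algebra_simps)
  then show ?thesis
    unfolding moment_def
    by (simp add: int integral_circle_monomial del: power_Suc add_2_eq_Suc' Suc_eq_plus1)
qed

context
  fixes p q :: real
  assumes pq: "p > 0" "q > 0" "p\<^sup>2 + q\<^sup>2 = 1"
begin

lemma parameter_bound: "\<bar>p\<^sup>2 - q\<^sup>2\<bar> < 1"
proof -
  have "p\<^sup>2 > 0" "q\<^sup>2 > 0" using pq by simp_all
  then show ?thesis using pq(3) by linarith
qed

lemma model_frame_kernel_quotient:
  "model_frame p q 1 = kernel_quotient (p\<^sup>2 - q\<^sup>2) q 0 q"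
  "model_frame p q 2 = kernel_quotient (p\<^sup>2 - q\<^sup>2) (\<i> * p) 0 (- (\<i> * p))"
  "model_frame p q 3 = kernel_quotient (p\<^sup>2 - q\<^sup>2) 0 (2 * p * q) 0"
  by (simp_all add: fun_eq_iff model_frame_def kernel_quotient_def algebra_simps)

lemma continuous_model_frame: "continuous_on (sphere 0 1) (model_frame p q j)"
proof -
  have "continuous_on (sphere 0 1) (kernel_quotient (p\<^sup>2 - q\<^sup>2) b\<^sub>0 b\<^sub>1 b\<^sub>2)" for b\<^sub>0 b\<^sub>1 b\<^sub>2
    unfolding kernel_quotient_def
    using denominator_nonzero[OF parameter_bound] by (intro continuous_intros) auto
  then show ?thesis using exhaust_3[of j] by (auto simp: model_frame_kernel_quotient)
qed

lemma model_frame_factor: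
  assumes "cmod z = 1"
  shows "model_frame p q j z = z / (1 - of_real (p\<^sup>2 - q\<^sup>2) * z\<^sup>2) * frame_factor p q j z"
proof -
  have "z * cnj z = 1" using assms by (simp add: complex_norm_square[symmetric])
  then have "1 + z\<^sup>2 = z * (z + cnj z)" "1 - z\<^sup>2 = z * (cnj z - z)"
    by (simp_all add: power2_eq_square algebra_simps)
  then show ?thesis by (simp add: model_frame_def frame_factor_def)
qed

text \<open>The unimodular factor \<open>z\<close> cancels against its conjugate and the frame
  factors are real on the circle, so the product is symmetric in \<open>i\<close> and
  \<open>j\<close>.\<close>

lemma model_frame_product:
  assumes "cmod z = 1"
  shows "model_frame p q i z * cnj (model_frame p q j z) =
    frame_factor p q i z * frame_factor p q j z / ((1 - of_real (p\<^sup>2 - q\<^sup>2) * z\<^sup>2) * cnj (1 - of_real (p\<^sup>2 - q\<^sup>2) * z\<^sup>2))"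
proof -
  have "z * cnj z = 1" using assms by (simp add: complex_norm_square[symmetric])
  moreover have "cnj (frame_factor p q j z) = frame_factor p q j z"
    by (simp add: frame_factor_def algebra_simps)
  ultimately have "z * frame_factor p q i z * (cnj z * cnj (frame_factor p q j z)) =
      frame_factor p q i z * frame_factor p q j z"
    by (metis mult.assoc mult.commute mult.left_neutral)
  then show ?thesis
    unfolding model_frame_factor[OF assms] by (simp del: complex_cnj_diff)
qed

text \<open>Up to symmetry six entries are expressed by five moments. The relation left over is
  \<open>G 3 3 = p^2 * G 1 1 + q^2 * G 2 2\<close>, since the second moments cancel on the
  right.\<close>

lemma frame_factor_moments:
  assumes \<mu>: "continuous_on (sphere 0 1) \<mu>"
  defines "G i j \<equiv> \<integral>z. \<mu> z * (frame_factor p q i z * frame_factor p q j z) \<partial>circle_measure"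
  shows "G 1 1 = q\<^sup>2 * (moment \<mu> 2 0 + 2 * moment \<mu> 0 0 + moment \<mu> 0 2)"
    "G 2 2 = p\<^sup>2 * (2 * moment \<mu> 0 0 - moment \<mu> 2 0 - moment \<mu> 0 2)"
    "G 3 3 = 4 * p\<^sup>2 * q\<^sup>2 * moment \<mu> 0 0"
    "G 1 2 = \<i> * p * q * (moment \<mu> 0 2 - moment \<mu> 2 0)"
    "G 1 3 = 2 * p * q\<^sup>2 * (moment \<mu> 1 0 + moment \<mu> 0 1)"
    "G 2 3 = 2 * \<i> * p\<^sup>2 * q * (moment \<mu> 0 1 - moment \<mu> 1 0)"
    "G i j = G j i"
proof -
  have int: "integrable circle_measure (\<lambda>z. \<mu> z * (z ^ m * cnj z ^ n))" for m n
    by (intro integrable_continuous_circle continuous_intros \<mu>)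
  have zz: "z * cnj z = 1" if "z \<in> space circle_measure" for z
    using that by (simp add: complex_norm_square[symmetric])
  \<comment> \<open>On the circle each product of two frame factors is a combination of these five
    monomials, so each entry follows from its coefficients.\<close>
  have lin: "G i j = a\<^sub>1 * moment \<mu> 2 0 + a\<^sub>2 * moment \<mu> 0 0 + a\<^sub>3 * moment \<mu> 0 2 + a\<^sub>4 * moment \<mu> 1 0 + a\<^sub>5 * moment \<mu> 0 1"
    if "\<And>z. z * cnj z = 1 \<Longrightarrow> frame_factor p q i z * frame_factor p q j z =
      a\<^sub>1 * z\<^sup>2 + a\<^sub>2 + a\<^sub>3 * (cnj z)\<^sup>2 + a\<^sub>4 * z + a\<^sub>5 * cnj z" for i j a\<^sub>1 a\<^sub>2 a\<^sub>3 a\<^sub>4 a\<^sub>5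
  proof -
    have "G i j = (\<integral>z. a\<^sub>1 * (\<mu> z * (z ^ 2 * cnj z ^ 0)) + a\<^sub>2 * (\<mu> z * (z ^ 0 * cnj z ^ 0))
        + a\<^sub>3 * (\<mu> z * (z ^ 0 * cnj z ^ 2)) + a\<^sub>4 * (\<mu> z * (z ^ 1 * cnj z ^ 0))
        + a\<^sub>5 * (\<mu> z * (z ^ 0 * cnj z ^ 1)) \<partial>circle_measure)"
      unfolding G_def using that zz
      by (intro Bochner_Integration.integral_cong refl) (simp add: algebra_simps)
    also have "\<dots> = a\<^sub>1 * moment \<mu> 2 0 + a\<^sub>2 * moment \<mu> 0 0 + a\<^sub>3 * moment \<mu> 0 2 + a\<^sub>4 * moment \<mu> 1 0 + a\<^sub>5 * moment \<mu> 0 1"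
      unfolding moment_def using int[of 2 0] int[of 0 0] int[of 0 2] int[of 1 0] int[of 0 1] by simp
    finally show ?thesis .
  qed
  have "(z + cnj z) * (z + cnj z) = z\<^sup>2 + 2 + (cnj z)\<^sup>2"
    "(cnj z - z) * (cnj z - z) = z\<^sup>2 - 2 + (cnj z)\<^sup>2"
    "(z + cnj z) * (cnj z - z) = (cnj z)\<^sup>2 - z\<^sup>2" if "z * cnj z = 1" for z :: complex
    using that by (simp_all add: power2_eq_square algebra_simps)
  note sq = this
  have "frame_factor p q 1 z * frame_factor p q 1 z = q\<^sup>2 * z\<^sup>2 + 2 * q\<^sup>2 + q\<^sup>2 * (cnj z)\<^sup>2 + 0 * z + 0 * cnj z"
    if "z * cnj z = 1" for z :: complex
  proof -
    have "frame_factor p q 1 z * frame_factor p q 1 z = q\<^sup>2 * ((z + cnj z) * (z + cnj z))"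
      by (simp add: frame_factor_def power2_eq_square)
    then show ?thesis unfolding sq[OF that] by (simp add: algebra_simps)
  qed
  from lin[OF this] show "G 1 1 = q\<^sup>2 * (moment \<mu> 2 0 + 2 * moment \<mu> 0 0 + moment \<mu> 0 2)"
    by (simp add: algebra_simps)
  have "frame_factor p q 2 z * frame_factor p q 2 z = - p\<^sup>2 * z\<^sup>2 + 2 * p\<^sup>2 + - p\<^sup>2 * (cnj z)\<^sup>2 + 0 * z + 0 * cnj z"
    if "z * cnj z = 1" for z :: complex
  proof -
    have "frame_factor p q 2 z * frame_factor p q 2 z = - p\<^sup>2 * ((cnj z - z) * (cnj z - z))"
      by (simp add: frame_factor_def power2_eq_square algebra_simps)
    then show ?thesis unfolding sq[OF that] by (simp add: algebra_simps)
  qed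
  from lin[OF this] show "G 2 2 = p\<^sup>2 * (2 * moment \<mu> 0 0 - moment \<mu> 2 0 - moment \<mu> 0 2)"
    by (simp add: algebra_simps)
  have "frame_factor p q 1 z * frame_factor p q 2 z = - (\<i> * p * q) * z\<^sup>2 + 0 + \<i> * p * q * (cnj z)\<^sup>2 + 0 * z + 0 * cnj z"
    if "z * cnj z = 1" for z :: complex
  proof -
    have "frame_factor p q 1 z * frame_factor p q 2 z = \<i> * p * q * ((z + cnj z) * (cnj z - z))"
      by (simp add: frame_factor_def)
    then show ?thesis unfolding sq[OF that] by (simp add: algebra_simps)
  qed
  from lin[OF this] show "G 1 2 = \<i> * p * q * (moment \<mu> 0 2 - moment \<mu> 2 0)"
    by (simp add: algebra_simps)
  show "G 3 3 = 4 * p\<^sup>2 * q\<^sup>2 * moment \<mu> 0 0"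
    by (subst lin[of 3 3 0 "4 * p\<^sup>2 * q\<^sup>2" 0 0 0]) (simp_all add: frame_factor_def power2_eq_square)
  show "G 1 3 = 2 * p * q\<^sup>2 * (moment \<mu> 1 0 + moment \<mu> 0 1)"
    by (subst lin[of 1 3 0 0 0 "2 * p * q\<^sup>2" "2 * p * q\<^sup>2"])
      (simp_all add: frame_factor_def power2_eq_square algebra_simps)
  show "G 2 3 = 2 * \<i> * p\<^sup>2 * q * (moment \<mu> 0 1 - moment \<mu> 1 0)"
    by (subst lin[of 2 3 0 0 0 "- 2 * \<i> * p\<^sup>2 * q" "2 * \<i> * p\<^sup>2 * q"])
      (simp_all add: frame_factor_def power2_eq_square algebra_simps)
  show "G i j = G j i" by (simp add: G_def mult.commute)
qed

text \<open>With \<open>a = p^2 - q^2\<close>, the weight times \<open>1 - a^2\<close> is the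
  Poisson kernel in the variable \<open>z^2\<close>, with Fourier series the sum of
  \<open>a^|n| z^(2n)\<close>. The moments are its coefficients, and \<open>p^2 + q^2 = 1\<close>
  makes \<open>1 - a^2\<close> equal to \<open>4 p^2 q^2\<close>.\<close>

lemma model_frame_moments_weight:
  defines "w z \<equiv> 1 / ((1 - of_real (p\<^sup>2 - q\<^sup>2) * z\<^sup>2) * cnj (1 - of_real (p\<^sup>2 - q\<^sup>2) * z\<^sup>2))"
  shows "continuous_on (sphere 0 1) w" "cmod z = 1 \<Longrightarrow> cnj (w z) = w z"
    "4 * p\<^sup>2 * q\<^sup>2 * moment w 0 0 = 1" "moment w 1 0 = 0" "4 * p\<^sup>2 * q\<^sup>2 * moment w 2 0 = p\<^sup>2 - q\<^sup>2"
proof -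
  define a where "a = p\<^sup>2 - q\<^sup>2"
  have a: "\<bar>a\<bar> < 1" using parameter_bound by (simp add: a_def)
  have a2: "1 - a * a = 4 * p\<^sup>2 * q\<^sup>2"
  proof -
    have "1 - a * a = (p\<^sup>2 + q\<^sup>2)\<^sup>2 - (p\<^sup>2 - q\<^sup>2)\<^sup>2" using pq(3) by (simp add: a_def power2_eq_square)
    then show ?thesis by (simp add: power2_eq_square algebra_simps)
  qed
  define u where "u z = 1 / (1 - of_real a * z\<^sup>2)" for z :: complex
  have w: "w z = u z * cnj (u z)" for z by (simp add: w_def u_def a_def)
  have nz: "1 - of_real a * z\<^sup>2 \<noteq> 0" if "cmod z = 1" for z
    using denominator_nonzero[OF a, of z] that by simp
  have contu: "continuous_on (sphere 0 1) u"
    unfolding u_def using nz by (intro continuous_intros) auto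
  then show "continuous_on (sphere 0 1) w" unfolding w by (intro continuous_intros)
  show "cmod z = 1 \<Longrightarrow> cnj (w z) = w z" by (simp add: w mult.commute)
  have bu: "boundary_function u u"
    using kernel_quotient_boundary[OF a, of 1 0 0] by (simp add: u_def[abs_def] kernel_quotient_def[abs_def])
  have u0: "(\<integral>z. u z \<partial>circle_measure) = 1"
    using boundary_integral_cnj_power[OF bu, of 0] by (simp add: taylor_coeff_def u_def)
  have uk: "(\<integral>z. u z * z ^ k \<partial>circle_measure) = 0" if "k > 0" for k
    by (rule boundary_integral_power[OF bu that])
  \<comment> \<open>The Poisson kernel split into an analytic function and the conjugate of one
    vanishing at 0, so that the moments of each part follow from those of \<open>u\<close>.\<close>
  have decomp: "(1 - of_real a * of_real a) * w z = u z + of_real a * ((cnj z)\<^sup>2 * cnj (u z))"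
    if z: "cmod z = 1" for z
  proof -
    have zz: "z * cnj z = 1" using z by (simp add: complex_norm_square[symmetric])
    have nz': "cnj (1 - of_real a * z\<^sup>2) \<noteq> 0" using nz[OF z] by (simp only: complex_cnj_zero_iff not_False_eq_True)
    have "u z + of_real a * ((cnj z)\<^sup>2 * cnj (u z)) =
        w z * (cnj (1 - of_real a * z\<^sup>2) + of_real a * (cnj z)\<^sup>2 * (1 - of_real a * z\<^sup>2))"
      using nz[OF z] nz' by (simp add: w u_def distrib_left)
    also have "cnj (1 - of_real a * z\<^sup>2) + of_real a * (cnj z)\<^sup>2 * (1 - of_real a * z\<^sup>2) =
        1 - of_real a * of_real a * (z * cnj z)\<^sup>2"
      by (simp add: algebra_simps power_mult_distrib)
    finally show ?thesis by (simp add: zz)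
  qed
  have mom: "(1 - of_real a * of_real a) * moment w k 0 =
      (\<integral>z. u z * z ^ k \<partial>circle_measure) + of_real a * (\<integral>z. (cnj z)\<^sup>2 * cnj (u z) * z ^ k \<partial>circle_measure)" for k
  proof -
    have "(1 - of_real a * of_real a) * moment w k 0 =
        (\<integral>z. (1 - of_real a * of_real a) * (w z * (z ^ k * cnj z ^ 0)) \<partial>circle_measure)"
      by (simp add: moment_def)
    also have "\<dots> = (\<integral>z. u z * z ^ k + of_real a * ((cnj z)\<^sup>2 * cnj (u z) * z ^ k) \<partial>circle_measure)"
    proof (intro Bochner_Integration.integral_cong refl)
      fix z assume "z \<in> space circle_measure"
      then have "(1 - of_real a * of_real a) * w z * z ^ k = (u z + of_real a * ((cnj z)\<^sup>2 * cnj (u z))) * z ^ k"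
        by (simp add: decomp)
      then show "(1 - of_real a * of_real a) * (w z * (z ^ k * cnj z ^ 0)) =
          u z * z ^ k + of_real a * ((cnj z)\<^sup>2 * cnj (u z) * z ^ k)"
        by (simp add: algebra_simps)
    qed
    also have "\<dots> = (\<integral>z. u z * z ^ k \<partial>circle_measure) +
        of_real a * (\<integral>z. (cnj z)\<^sup>2 * cnj (u z) * z ^ k \<partial>circle_measure)"
    proof -
      have "integrable circle_measure (\<lambda>z. u z * z ^ k)"
        "integrable circle_measure (\<lambda>z. (cnj z)\<^sup>2 * cnj (u z) * z ^ k)"
        by (intro integrable_continuous_circle continuous_intros contu)+
      then show ?thesis by simp
    qed
    finally show ?thesis .
  qed
  have c: "complex_of_real (4 * p\<^sup>2 * q\<^sup>2) = 1 - of_real a * of_real a"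
    by (simp flip: a2)
  have ck: "(\<integral>z. cnj (u z) * cnj z ^ k \<partial>circle_measure) = (if k = 0 then 1 else 0)" for k
    using integral_circle_cnj[of "\<lambda>z. u z * z ^ k"] u0 uk[of k] by simp
  have "(\<integral>z. (cnj z)\<^sup>2 * cnj (u z) * z ^ 0 \<partial>circle_measure) = 0"
    using ck[of 2] by (simp add: mult.commute)
  then show "4 * p\<^sup>2 * q\<^sup>2 * moment w 0 0 = 1"
    using mom[of 0] u0 c by simp
  have "(\<integral>z. (cnj z)\<^sup>2 * cnj (u z) * z ^ k \<partial>circle_measure) = (\<integral>z. cnj (u z) * cnj z ^ (2 - k) \<partial>circle_measure)"
    if "k \<le> 2" for k
  proof (intro Bochner_Integration.integral_cong refl)
    fix z assume "z \<in> space circle_measure"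
    then have zz: "z * cnj z = 1" by (simp add: complex_norm_square[symmetric])
    have "(cnj z)\<^sup>2 = cnj z ^ (2 - k) * cnj z ^ k" using that by (simp flip: power_add)
    then have "(cnj z)\<^sup>2 * cnj (u z) * z ^ k = cnj (u z) * cnj z ^ (2 - k) * (z * cnj z) ^ k"
      by (simp add: power_mult_distrib mult_ac)
    then show "(cnj z)\<^sup>2 * cnj (u z) * z ^ k = cnj (u z) * cnj z ^ (2 - k)" by (simp add: zz)
  qed
  note this[of 1] this[of 2]
  then have k12: "(\<integral>z. (cnj z)\<^sup>2 * cnj (u z) * z ^ 1 \<partial>circle_measure) = 0"
    "(\<integral>z. (cnj z)\<^sup>2 * cnj (u z) * z ^ 2 \<partial>circle_measure) = 1"
    using ck[of 1] ck[of 0] by simp_all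
  have "1 - of_real a * of_real a \<noteq> (0 :: complex)" using c pq by auto
  then show "moment w 1 0 = 0" using mom[of 1] k12 uk[of 1] by simp
  show "4 * p\<^sup>2 * q\<^sup>2 * moment w 2 0 = p\<^sup>2 - q\<^sup>2"
    using mom[of 2] k12 uk[of 2] c by (simp add: a_def)
qed

end

section \<open>Gram matrix of the frame and prescribed compressions\<close>

context
  fixes p q :: real
  assumes pq: "p > 0" "q > 0" "p\<^sup>2 + q\<^sup>2 = 1"
begin

text \<open>The factor of \<open>c\<close> absorbs the common weight of the frame products. The
  choice \<open>c = 1\<close> leads to the Gram matrix, a Laurent polynomial \<open>\<mu>\<close> to
  the matrix of a Toeplitz compression.\<close>

lemma model_frame_gram:
  assumes "\<And>z. cmod z = 1 \<Longrightarrow>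
    c z = \<mu> z * ((1 - of_real (p\<^sup>2 - q\<^sup>2) * z\<^sup>2) * cnj (1 - of_real (p\<^sup>2 - q\<^sup>2) * z\<^sup>2))"
  shows "(\<integral>z. c z * (model_frame p q i z * cnj (model_frame p q j z)) \<partial>circle_measure) =
    (\<integral>z. \<mu> z * (frame_factor p q i z * frame_factor p q j z) \<partial>circle_measure)"
proof (intro Bochner_Integration.integral_cong refl)
  fix z assume "z \<in> space circle_measure"
  then have z: "cmod z = 1" by simp
  have "1 - of_real (p\<^sup>2 - q\<^sup>2) * z\<^sup>2 \<noteq> 0"
    using denominator_nonzero[OF parameter_bound[OF pq], of z] z by simp
  then have "(1 - of_real (p\<^sup>2 - q\<^sup>2) * z\<^sup>2) * cnj (1 - of_real (p\<^sup>2 - q\<^sup>2) * z\<^sup>2) \<noteq> 0"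
    by (simp only: complex_cnj_zero_iff mult_eq_0_iff not_False_eq_True simp_thms)
  then show "c z * (model_frame p q i z * cnj (model_frame p q j z)) =
      \<mu> z * (frame_factor p q i z * frame_factor p q j z)"
    unfolding model_frame_product[OF pq z] assms[OF z] by (simp del: complex_cnj_diff)
qed

lemma model_frame_orthonormal:
  "(\<integral>z. model_frame p q i z * cnj (model_frame p q j z) \<partial>circle_measure) = (if i = j then 1 else 0)"
proof -
  define w where "w z = 1 / ((1 - complex_of_real (p\<^sup>2 - q\<^sup>2) * z\<^sup>2) * cnj (1 - of_real (p\<^sup>2 - q\<^sup>2) * z\<^sup>2))" for z
  note m = model_frame_moments_weight[OF pq, folded w_def]
  define A :: complex where "A = 4 * p\<^sup>2 * q\<^sup>2"
  define a :: complex where "a = of_real (p\<^sup>2 - q\<^sup>2)"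
  have A: "A \<noteq> 0" using pq by (simp add: A_def)
  have m00: "moment w 0 0 = 1 / A" and m20: "moment w 2 0 = a / A"
    using m(3,5) A by (simp_all add: A_def a_def eq_divide_eq mult.commute)
  have m02: "moment w 0 2 = a / A" and m01: "moment w 0 1 = 0"
    using moment_conjugate[of w 0 2] moment_conjugate[of w 0 1] m(2,4) m20
    by (simp_all add: A_def a_def)
  \<comment> \<open>These two values explain the normalization of the frame: each of the first two
    square norms is \<open>4 p^2 q^2\<close> divided by \<open>A\<close>.\<close>
  have a': "1 + a = 2 * p\<^sup>2" "1 - a = 2 * q\<^sup>2"
  proof -
    have "1 + (p\<^sup>2 - q\<^sup>2) = 2 * p\<^sup>2" "1 - (p\<^sup>2 - q\<^sup>2) = 2 * q\<^sup>2" using pq(3) by linarith+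
    from arg_cong[OF this(1), of complex_of_real] arg_cong[OF this(2), of complex_of_real]
    show "1 + a = 2 * p\<^sup>2" "1 - a = 2 * q\<^sup>2" by (simp_all add: a_def)
  qed
  have "(1 - complex_of_real (p\<^sup>2 - q\<^sup>2) * z\<^sup>2) \<noteq> 0" if "cmod z = 1" for z
    using denominator_nonzero[OF parameter_bound[OF pq], of z] that by simp
  then have "(1 - complex_of_real (p\<^sup>2 - q\<^sup>2) * z\<^sup>2) * cnj (1 - of_real (p\<^sup>2 - q\<^sup>2) * z\<^sup>2) \<noteq> 0"
    if "cmod z = 1" for z
    using that by (simp only: complex_cnj_zero_iff mult_eq_0_iff not_False_eq_True simp_thms)
  then have gram: "(\<integral>z. model_frame p q i z * cnj (model_frame p q j z) \<partial>circle_measure) =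
      (\<integral>z. w z * (frame_factor p q i z * frame_factor p q j z) \<partial>circle_measure)" for i j
    using model_frame_gram[of "\<lambda>_. 1" w i j] by (simp add: w_def del: complex_cnj_diff)
  note G = frame_factor_moments[OF pq m(1), folded gram]
  have "p\<^sup>2 * (2 * (1 / A) - a / A - a / A) = p\<^sup>2 * (2 * (1 - a)) / A"
    "q\<^sup>2 * (a / A + 2 * (1 / A) + a / A) = q\<^sup>2 * (2 * (1 + a)) / A"
    by (simp_all add: algebra_simps diff_divide_distrib add_divide_distrib)
  then have diag: "p\<^sup>2 * (2 * (1 / A) - a / A - a / A) = 1" "q\<^sup>2 * (a / A + 2 * (1 / A) + a / A) = 1"
    "4 * p\<^sup>2 * q\<^sup>2 * (1 / A) = 1"
    using A unfolding a' by (simp_all add: A_def)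
  show ?thesis
    using exhaust_3[of i] exhaust_3[of j] G(1-6)[unfolded m00 m20 m02 m01 m(4) diag]
      G(7)[of 2 1] G(7)[of 3 1] G(7)[of 3 2]
    by auto
qed

text \<open>Five moments of \<open>\<psi>\<close> can be prescribed freely and determine every entry
  but \<open>N $ 2 $ 2\<close>; that one is then forced, and the hypothesis \<open>mean\<close> says
  that it comes out right.\<close>

lemma symbol_with_matrix:
  fixes N :: "complex ^ 3 ^ 3"
  assumes sym: "transpose N = N"
    and mean: "N $ 3 $ 3 = of_real (p\<^sup>2) * N $ 1 $ 1 + of_real (q\<^sup>2) * N $ 2 $ 2"
  obtains c where "continuous_on (sphere 0 1) c"
    "\<And>i j. (\<integral>z. c z * (model_frame p q j z * cnj (model_frame p q i z)) \<partial>circle_measure) = N $ i $ j"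
proof -
  define P Q where "P = complex_of_real p" and "Q = complex_of_real q"
  have PQ: "P \<noteq> 0" "Q \<noteq> 0" using pq by (simp_all add: P_def Q_def)
  define c\<^sub>0 where "c\<^sub>0 = N $ 3 $ 3 / (4 * P\<^sup>2 * Q\<^sup>2)"
  \<comment> \<open>Sum and difference of the second moments, then of the first: the combinations in
    which the entries are linear and decoupled.\<close>
  define s t u v where "s = N $ 1 $ 1 / Q\<^sup>2 - 2 * c\<^sub>0" and "t = N $ 1 $ 2 / (\<i> * P * Q)"
    and "u = N $ 1 $ 3 / (2 * P * Q\<^sup>2)" and "v = N $ 2 $ 3 / (2 * \<i> * P\<^sup>2 * Q)"
  define \<psi> where "\<psi> = laurent_symbol c\<^sub>0 ((u - v) / 2) ((u + v) / 2) ((s - t) / 2) ((s + t) / 2)"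
  define c where "c z = \<psi> z * ((1 - of_real (p\<^sup>2 - q\<^sup>2) * z\<^sup>2) * cnj (1 - of_real (p\<^sup>2 - q\<^sup>2) * z\<^sup>2))" for z
  have cont: "continuous_on (sphere 0 1) \<psi>"
    unfolding \<psi>_def laurent_symbol_def by (intro continuous_intros)
  then have "continuous_on (sphere 0 1) c" unfolding c_def by (intro continuous_intros)
  moreover have gram: "(\<integral>z. c z * (model_frame p q i z * cnj (model_frame p q j z)) \<partial>circle_measure) =
      (\<integral>z. \<psi> z * (frame_factor p q i z * frame_factor p q j z) \<partial>circle_measure)" for i j
    by (rule model_frame_gram) (simp add: c_def)
  note G = frame_factor_moments[OF pq cont, folded gram P_def Q_def, unfolded of_real_power of_real_mult of_real_numeral, folded P_def Q_def]
  have m: "moment \<psi> 0 0 = c\<^sub>0" "moment \<psi> 1 0 = (u - v) / 2" "moment \<psi> 0 1 = (u + v) / 2"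
    "moment \<psi> 2 0 = (s - t) / 2" "moment \<psi> 0 2 = (s + t) / 2"
    by (simp_all add: \<psi>_def moment_laurent_symbol)
  \<comment> \<open>The single entry for which no free moment is left.\<close>
  have N22: "P\<^sup>2 * (2 * c\<^sub>0 - s) = N $ 2 $ 2"
  proof -
    have "P\<^sup>2 * (2 * c\<^sub>0 - s) = (4 * P\<^sup>2 * Q\<^sup>2 * c\<^sub>0 - P\<^sup>2 * N $ 1 $ 1) / Q\<^sup>2"
      using PQ by (simp add: s_def field_simps)
    also have "4 * P\<^sup>2 * Q\<^sup>2 * c\<^sub>0 = N $ 3 $ 3" using PQ by (simp add: c\<^sub>0_def)
    finally show ?thesis using mean PQ by (simp add: P_def Q_def)
  qed
  have halves: "(s - t) / 2 + 2 * c\<^sub>0 + (s + t) / 2 = N $ 1 $ 1 / Q\<^sup>2" "(s + t) / 2 - (s - t) / 2 = t"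
    "(u - v) / 2 + (u + v) / 2 = u" "(u + v) / 2 - (u - v) / 2 = v"
    "2 * c\<^sub>0 - (s - t) / 2 - (s + t) / 2 = 2 * c\<^sub>0 - s"
    by (simp_all add: s_def field_simps)
  note G' = G(1-6)[unfolded m halves N22]
  have symN: "N $ i $ j = N $ j $ i" for i j
    using arg_cong[OF sym, of "\<lambda>X. X $ j $ i"] by (simp add: transpose_def)
  have vals: "(\<integral>z. c z * (model_frame p q 1 z * cnj (model_frame p q 1 z)) \<partial>circle_measure) = N $ 1 $ 1"
    "(\<integral>z. c z * (model_frame p q 2 z * cnj (model_frame p q 2 z)) \<partial>circle_measure) = N $ 2 $ 2"
    "(\<integral>z. c z * (model_frame p q 3 z * cnj (model_frame p q 3 z)) \<partial>circle_measure) = N $ 3 $ 3"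
    "(\<integral>z. c z * (model_frame p q 1 z * cnj (model_frame p q 2 z)) \<partial>circle_measure) = N $ 1 $ 2"
    "(\<integral>z. c z * (model_frame p q 1 z * cnj (model_frame p q 3 z)) \<partial>circle_measure) = N $ 1 $ 3"
    "(\<integral>z. c z * (model_frame p q 2 z * cnj (model_frame p q 3 z)) \<partial>circle_measure) = N $ 2 $ 3"
    unfolding G' using PQ by (simp_all add: c\<^sub>0_def t_def u_def v_def)
  \<comment> \<open>The entry with indices \<open>i j\<close> pairs the image of frame vector
    \<open>j\<close> with frame vector \<open>i\<close>; the reversal against \<open>vals\<close> is
    absorbed by the symmetry of both sides.\<close>
  moreover have "(\<integral>z. c z * (model_frame p q j z * cnj (model_frame p q i z)) \<partial>circle_measure) = N $ i $ j" for i j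
    using exhaust_3[of i] exhaust_3[of j] vals G(7)[of 1 2] G(7)[of 1 3] G(7)[of 2 3]
      symN[of 1 2] symN[of 1 3] symN[of 2 3] by auto
  ultimately show ?thesis using that by blast
qed

section \<open>Coordinates on the model space\<close>

definition frame_sum :: "complex ^ 3 \<Rightarrow> complex \<Rightarrow> complex" where
  "frame_sum y z = (\<Sum>j\<in>UNIV. y $ j * model_frame p q j z)"

definition frame_map :: "complex ^ 3 \<Rightarrow> ltwo" where
  "frame_map y = abs_ltwo (frame_sum y)"

lemma frame_sum_kernel_quotient:
  "frame_sum y = kernel_quotient (p\<^sup>2 - q\<^sup>2) (q * y $ 1 + \<i> * p * y $ 2) (2 * p * q * y $ 3)
    (q * y $ 1 - \<i> * p * y $ 2)"
  by (simp add: fun_eq_iff frame_sum_def sum_3 model_frame_kernel_quotient[OF pq] kernel_quotient_def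
      add_divide_distrib[symmetric] algebra_simps)

lemma square_integrable_frame_sum: "square_integrable (frame_sum y)"
  unfolding frame_sum_kernel_quotient
  by (rule square_integrable_kernel_quotient[OF parameter_bound[OF pq]])

lemma range_frame_map: "range frame_map = model_space (blaschke (p\<^sup>2 - q\<^sup>2))"
proof
  show "range frame_map \<subseteq> model_space (blaschke (p\<^sup>2 - q\<^sup>2))"
    using kernel_quotient_in_model_space[OF parameter_bound[OF pq]]
    by (auto simp: frame_map_def frame_sum_kernel_quotient)
  show "model_space (blaschke (p\<^sup>2 - q\<^sup>2)) \<subseteq> range frame_map"
  proof
    fix x assume "x \<in> model_space (blaschke (p\<^sup>2 - q\<^sup>2))"
    then obtain b\<^sub>0 b\<^sub>1 b\<^sub>2 where x: "x = abs_ltwo (kernel_quotient (p\<^sup>2 - q\<^sup>2) b\<^sub>0 b\<^sub>1 b\<^sub>2)"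
      using model_space_kernel_quotient[OF parameter_bound[OF pq]] by blast
    \<comment> \<open>Solves the coefficient formulas of \<open>frame_sum_kernel_quotient\<close>
      for the coordinates; dividing by \<open>p\<close> and \<open>q\<close> is possible because
      both are positive.\<close>
    define y :: "complex ^ 3" where
      "y = vector [(b\<^sub>0 + b\<^sub>2) / (2 * q), (b\<^sub>0 - b\<^sub>2) / (2 * \<i> * p), b\<^sub>1 / (2 * p * q)]"
    have "q * y $ 1 = (b\<^sub>0 + b\<^sub>2) / 2" "\<i> * p * y $ 2 = (b\<^sub>0 - b\<^sub>2) / 2" "2 * p * q * y $ 3 = b\<^sub>1"
      using pq by (simp_all add: y_def)
    note y = this
    have "(b\<^sub>0 + b\<^sub>2) / 2 + (b\<^sub>0 - b\<^sub>2) / 2 = b\<^sub>0" "(b\<^sub>0 + b\<^sub>2) / 2 - (b\<^sub>0 - b\<^sub>2) / 2 = b\<^sub>2"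
      by (simp_all add: field_simps)
    then have "frame_sum y = kernel_quotient (p\<^sup>2 - q\<^sup>2) b\<^sub>0 b\<^sub>1 b\<^sub>2"
      unfolding frame_sum_kernel_quotient y by simp
    then show "x \<in> range frame_map" using x by (intro range_eqI[of _ _ y]) (simp add: frame_map_def)
  qed
qed

lemma frame_coefficient:
  assumes c: "continuous_on (sphere 0 1) c"
  shows "(\<integral>z. c z * frame_sum y z * cnj (model_frame p q i z) \<partial>circle_measure) =
    (\<Sum>j\<in>UNIV. y $ j * (\<integral>z. c z * (model_frame p q j z * cnj (model_frame p q i z)) \<partial>circle_measure))"
proof -
  have "integrable circle_measure (\<lambda>z. y $ j * (c z * (model_frame p q j z * cnj (model_frame p q i z))))" for j
    by (intro integrable_continuous_circle continuous_intros continuous_model_frame[OF pq] c)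
  then have "(\<integral>z. (\<Sum>j\<in>UNIV. y $ j * (c z * (model_frame p q j z * cnj (model_frame p q i z)))) \<partial>circle_measure) =
      (\<Sum>j\<in>UNIV. (\<integral>z. y $ j * (c z * (model_frame p q j z * cnj (model_frame p q i z))) \<partial>circle_measure))"
    by (intro Bochner_Integration.integral_sum)
  moreover have "c z * frame_sum y z * cnj (model_frame p q i z) =
      (\<Sum>j\<in>UNIV. y $ j * (c z * (model_frame p q j z * cnj (model_frame p q i z))))" for z
    by (simp add: frame_sum_def sum_distrib_left sum_distrib_right mult_ac)
  ultimately show ?thesis by simp
qed

lemma integrable_mult_cnj_model_frame:
  assumes "square_integrable h"
  shows "integrable circle_measure (\<lambda>z. h z * cnj (model_frame p q i z))"
proof -
  have cont: "continuous_on (sphere 0 1) (\<lambda>z. cnj (model_frame p q i z))"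
    by (intro continuous_intros continuous_model_frame[OF pq])
  obtain K where "\<And>z. cmod z = 1 \<Longrightarrow> cmod (cnj (model_frame p q i z)) \<le> K"
    using bounded_continuous_circle[OF cont] by blast
  from integrable_mult_bounded[OF assms borel_measurable_circleI[OF cont] this]
  show ?thesis by (simp add: mult.commute)
qed

lemma inner_frame_map:
  assumes "square_integrable h"
  shows "ltwo_inner (abs_ltwo h) (frame_map y) =
    (\<Sum>i\<in>UNIV. cnj (y $ i) * (\<integral>z. h z * cnj (model_frame p q i z) \<partial>circle_measure))"
proof -
  have "integrable circle_measure (\<lambda>z. cnj (y $ i) * (h z * cnj (model_frame p q i z)))" for i
    by (intro integrable_mult_right integrable_mult_cnj_model_frame assms)
  then have "(\<integral>z. (\<Sum>i\<in>UNIV. cnj (y $ i) * (h z * cnj (model_frame p q i z))) \<partial>circle_measure) =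
      (\<Sum>i\<in>UNIV. (\<integral>z. cnj (y $ i) * (h z * cnj (model_frame p q i z)) \<partial>circle_measure))"
    by (intro Bochner_Integration.integral_sum)
  moreover have "h z * cnj (frame_sum y z) = (\<Sum>i\<in>UNIV. cnj (y $ i) * (h z * cnj (model_frame p q i z)))" for z
    by (simp add: frame_sum_def sum_distrib_left mult_ac)
  ultimately show ?thesis
    using assms square_integrable_frame_sum by (simp add: frame_map_def ltwo_inner_abs)
qed

lemma coefficient_frame_sum:
  "(\<integral>z. frame_sum y z * cnj (model_frame p q i z) \<partial>circle_measure) = y $ i"
  using frame_coefficient[of "\<lambda>_. 1" y i] by (simp add: model_frame_orthonormal if_distrib cong: if_cong)

lemma inner_frame_map_frame_map:
  "ltwo_inner (frame_map x) (frame_map y) = (\<Sum>i\<in>UNIV. x $ i * cnj (y $ i))"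
  using inner_frame_map[OF square_integrable_frame_sum, of x y]
  by (simp add: coefficient_frame_sum frame_map_def mult.commute)

lemma inj_frame_map: "inj frame_map"
proof (rule injI)
  fix x y assume eq: "frame_map x = frame_map y"
  have "ltwo_inner (frame_map v) (frame_map (axis i 1)) = v $ i" for v i
    unfolding inner_frame_map_frame_map by (simp add: axis_def if_distrib cong: if_cong)
  then show "x = y" using eq by (metis vec_eq_iff)
qed

lemma frame_map_add: "frame_map (x + y) = frame_map x + frame_map y"
  using square_integrable_frame_sum
  by (simp add: frame_map_def plus_abs_ltwo frame_sum_def[abs_def] distrib_right sum.distrib)

lemma frame_map_scale: "frame_map (c *s x) = ltwo_scale c (frame_map x)"
  using square_integrable_frame_sum[of x]
  by (simp add: frame_map_def scale_abs_ltwo frame_sum_def[abs_def] sum_distrib_left mult.assoc)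

text \<open>The projection is given by a definite description, so existence and uniqueness are both
  due; the orthonormal frame gives the first by expansion and the second by testing against single
  frame vectors.\<close>

lemma projection_model_space:
  assumes h: "square_integrable h"
  shows "ltwo_projection (model_space (blaschke (p\<^sup>2 - q\<^sup>2))) (abs_ltwo h) =
    frame_map (\<chi> i. \<integral>z. h z * cnj (model_frame p q i z) \<partial>circle_measure)"
proof -
  define d :: "complex ^ 3" where "d = (\<chi> i. \<integral>z. h z * cnj (model_frame p q i z) \<partial>circle_measure)"
  have inner: "ltwo_inner (abs_ltwo h - frame_map x) (frame_map y) = (\<Sum>i\<in>UNIV. cnj (y $ i) * (d $ i - x $ i))" for x y
  proof -
    have "ltwo_inner (abs_ltwo h - frame_map x) (frame_map y) =
        ltwo_inner (abs_ltwo (\<lambda>z. h z - frame_sum x z)) (frame_map y)"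
      using h square_integrable_frame_sum by (simp add: frame_map_def[of x] minus_abs_ltwo)
    also have "\<dots> = (\<Sum>i\<in>UNIV. cnj (y $ i) *
        (\<integral>z. h z * cnj (model_frame p q i z) - frame_sum x z * cnj (model_frame p q i z) \<partial>circle_measure))"
      using h square_integrable_frame_sum
      by (subst inner_frame_map) (simp_all add: square_integrable_diff left_diff_distrib)
    also have "\<dots> = (\<Sum>i\<in>UNIV. cnj (y $ i) * (d $ i - x $ i))"
      using integrable_mult_cnj_model_frame[OF h]
        integrable_mult_cnj_model_frame[OF square_integrable_frame_sum]
      by (simp add: coefficient_frame_sum d_def)
    finally show ?thesis .
  qed
  show ?thesis
    unfolding ltwo_projection_def range_frame_map[symmetric] d_def[symmetric]
  proof (rule the_equality)
    show "frame_map d \<in> range frame_map \<and> (\<forall>k\<in>range frame_map. ltwo_inner (abs_ltwo h - frame_map d) k = 0)"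
      by (auto simp: inner)
    fix f assume f: "f \<in> range frame_map \<and> (\<forall>k\<in>range frame_map. ltwo_inner (abs_ltwo h - f) k = 0)"
    then obtain x where x: "f = frame_map x" by blast
    have "d $ i - x $ i = 0" for i
    proof -
      have "0 = ltwo_inner (abs_ltwo h - frame_map x) (frame_map (axis i 1))" using f x by simp
      also have "\<dots> = d $ i - x $ i" unfolding inner by (simp add: axis_def if_distrib if_distribR cong: if_cong)
      finally show ?thesis by simp
    qed
    then have "x = d" by (simp add: vec_eq_iff)
    then show "f = frame_map d" using x by simp
  qed
qed

lemma truncated_toeplitz_frame_map:
  assumes c: "continuous_on (sphere 0 1) c"
    and N: "\<And>i j. (\<integral>z. c z * (model_frame p q j z * cnj (model_frame p q i z)) \<partial>circle_measure) = N $ i $ j"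
  shows "truncated_toeplitz (blaschke (p\<^sup>2 - q\<^sup>2)) (abs_ltwo c) (frame_map y) = Some (frame_map (N *v y))"
proof -
  obtain K where K: "\<And>z. cmod z = 1 \<Longrightarrow> cmod (c z) \<le> K"
    using bounded_continuous_circle[OF c] by blast
  have c_meas: "c \<in> borel_measurable circle_measure" by (rule borel_measurable_circleI[OF c])
  have sq1: "square_integrable (\<lambda>_. 1)" by (simp add: square_integrable_def)
  have c_sq: "square_integrable c"
    using square_integrable_mult_bounded[OF sq1 c_meas K] by simp
  define h where "h z = c z * frame_sum y z" for z
  \<comment> \<open>The operator multiplies chosen representatives of the two classes, which agree
    with \<open>c\<close> and \<open>frame_sum y\<close> only almost everywhere. Square
    integrability and the class of the product must be transferred from \<open>h\<close>.\<close>
  define h' where "h' z = rep_ltwo (abs_ltwo c) z * rep_ltwo (frame_map y) z" for z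
  have h: "square_integrable h"
    unfolding h_def by (rule square_integrable_mult_bounded[OF square_integrable_frame_sum c_meas K])
  have eq: "AE z in circle_measure. h z = h' z"
    using rep_abs_ltwo[OF c_sq] rep_abs_ltwo[OF square_integrable_frame_sum[of y]]
    by eventually_elim (simp add: h_def h'_def frame_map_def)
  have meas: "h' \<in> borel_measurable circle_measure"
    unfolding h'_def
    by (intro borel_measurable_times square_integrable_rep_ltwo[unfolded square_integrable_def, THEN conjunct1])
  have "integrable circle_measure (\<lambda>z. (cmod (h' z))\<^sup>2)"
  proof (rule integrable_cong_AE_imp)
    show "integrable circle_measure (\<lambda>z. (cmod (h z))\<^sup>2)" using h by (simp add: square_integrable_def)
    show "(\<lambda>z. (cmod (h' z))\<^sup>2) \<in> borel_measurable circle_measure" using meas by simp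
    show "AE z in circle_measure. (cmod (h z))\<^sup>2 = (cmod (h' z))\<^sup>2" using eq by eventually_elim simp
  qed
  then have h': "square_integrable h'" using meas by (simp add: square_integrable_def)
  have "abs_ltwo h' = abs_ltwo h" using h h' eq by (intro abs_ltwo_eqI) (auto simp: eq_commute)
  moreover have "(\<chi> i. \<integral>z. h z * cnj (model_frame p q i z) \<partial>circle_measure) = N *v y"
    unfolding h_def frame_coefficient[OF c] N by (simp add: vec_eq_iff matrix_vector_mult_def mult.commute)
  ultimately have "ltwo_projection (model_space (blaschke (p\<^sup>2 - q\<^sup>2))) (abs_ltwo h') = frame_map (N *v y)"
    using projection_model_space[OF h] by simp
  then show ?thesis
    using h' range_frame_map by (auto simp: truncated_toeplitz_def Let_def h'_def[abs_def])
qed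

end

theorem theorem5p2:
  fixes M :: "complex ^ 3 ^ 3"
  assumes "M = transpose M"
  shows "\<exists>(m::nat) (\<Theta> :: nat \<Rightarrow> complex \<Rightarrow> complex) (\<phi> :: nat \<Rightarrow> ltwo).
    m \<ge> 1 \<and>
    (\<forall>k<m. inner_function (\<Theta> k) \<and> \<not> \<Theta> k constant_on ball 0 1) \<and>
    unitarily_equivalent
      standard_space (\<lambda>x. Some (M *v x))
      (direct_sum m (\<lambda>k. ltwo_subspace (model_space (\<Theta> k))))
      (direct_sum_operator m (\<lambda>k. truncated_toeplitz (\<Theta> k) (\<phi> k)))"
proof -
  obtain V :: "complex ^ 3 ^ 3" and p q :: real
    where V: "\<forall>i j. V $ i $ j \<in> \<real>" "transpose V ** V = mat 1"
      and pq: "p > 0" "q > 0" "p\<^sup>2 + q\<^sup>2 = 1"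
      and mean: "(transpose V ** M ** V) $ 3 $ 3 = of_real (p\<^sup>2) * (transpose V ** M ** V) $ 1 $ 1 +
        of_real (q\<^sup>2) * (transpose V ** M ** V) $ 2 $ 2"
    by (rule complex_symmetric_frame[OF assms[symmetric]])
  define N where "N = transpose V ** M ** V"
  have "transpose N = N" unfolding N_def by (rule transpose_conjugate_symmetric[OF assms[symmetric]])
  then obtain c where c: "continuous_on (sphere 0 1) c"
    "\<And>i j. (\<integral>z. c z * (model_frame p q j z * cnj (model_frame p q i z)) \<partial>circle_measure) = N $ i $ j"
    using symbol_with_matrix[OF pq _ mean[folded N_def]] by blast
  define \<Theta> where "\<Theta> = blaschke (p\<^sup>2 - q\<^sup>2)"
  \<comment> \<open>\<open>transpose V\<close> passes to coordinates in the frame where the matrix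
    is \<open>N\<close>, and \<open>frame_map\<close> sends those to the model space.\<close>
  define u where "u x = frame_map p q (transpose V *v x)" for x
  have VV: "V ** transpose V = mat 1" using V(2) by (simp add: matrix_left_right_inverse)
  have inv: "transpose V *v (V *v x) = x" "V *v (transpose V *v x) = x" for x
    using V(2) VV by (simp_all add: matrix_vector_mul_assoc del: transpose_matrix_vector)
  have bij: "bij_betw u UNIV (model_space \<Theta>)"
  proof -
    have "bij ((*v) (transpose V))" by (rule o_bij[of "(*v) V"]) (simp_all add: fun_eq_iff inv del: transpose_matrix_vector)
    moreover have "bij_betw (frame_map p q) UNIV (model_space \<Theta>)"
      using inj_frame_map[OF pq] range_frame_map[OF pq] by (simp add: bij_betw_def \<Theta>_def)
    ultimately show ?thesis
      unfolding u_def using bij_betw_trans[of "(*v) (transpose V)" UNIV UNIV "frame_map p q"]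
      by (simp add: comp_def del: transpose_matrix_vector)
  qed
  have inner: "ltwo_inner (u x) (u y) = (\<Sum>i\<in>UNIV. x $ i * cnj (y $ i))" for x y
  proof -
    \<comment> \<open>Because \<open>V\<close> is real, its transpose is its adjoint, so the change
      of coordinates is unitary.\<close>
    have real: "cnj (V $ i $ j) = V $ i $ j" for i j using V(1) by (simp add: Reals_cnj_iff)
    have "ltwo_inner (u x) (u y) = (\<Sum>i\<in>UNIV. (transpose V *v x) $ i * cnj ((transpose V *v y) $ i))"
      by (simp add: u_def inner_frame_map_frame_map[OF pq])
    also have "\<dots> = (\<Sum>i\<in>UNIV. (transpose V *v x) $ i * (transpose V *v (\<chi> j. cnj (y $ j))) $ i)"
      by (simp add: matrix_vector_mult_def transpose_def real)
    also have "\<dots> = (\<Sum>i\<in>UNIV. (V *v (transpose V *v x)) $ i * (\<chi> j. cnj (y $ j)) $ i)"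
      by (simp add: matrix_vector_mult_def[of _ "\<chi> j. cnj (y $ j)"] matrix_vector_mult_def[of V]
          transpose_def sum_distrib_left sum_distrib_right mult_ac) (rule sum.swap)
    finally show ?thesis by (simp only: inv vec_lambda_beta)
  qed
  have toeplitz: "truncated_toeplitz \<Theta> (abs_ltwo c) (u x) = Some (u (M *v x))" for x
  proof -
    have "N *v (transpose V *v x) = transpose V *v (M *v x)"
      by (simp add: N_def matrix_vector_mul_assoc matrix_mul_assoc[symmetric] VV del: transpose_matrix_vector)
    then show ?thesis
      using truncated_toeplitz_frame_map[OF pq c, of "transpose V *v x"] by (simp add: \<Theta>_def u_def del: transpose_matrix_vector)
  qed
  let ?Y = "direct_sum 1 (\<lambda>_. ltwo_subspace (model_space \<Theta>))"
  \<comment> \<open>A direct sum with one summand still consists of functions on an index set; the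
    restriction gives them the default value off index 0, as extensionality demands.\<close>
  define U where "U x = (\<lambda>k\<in>{..<1::nat}. u x)" for x
  have "unitary_map standard_space ?Y U"
    unfolding unitary_map_def
  proof (intro conjI)
    show "bij_betw U (vectors standard_space) (vectors ?Y)"
    proof (rule bij_betw_imageI)
      show "inj_on U (vectors standard_space)"
      proof (rule inj_onI)
        fix x y assume "U x = U y"
        then have "U x 0 = U y 0" by simp
        then show "x = y" using bij by (simp add: U_def bij_betw_def inj_eq)
      qed
      have "f \<in> range U" if f: "f \<in> {..<1} \<rightarrow>\<^sub>E model_space \<Theta>" for f
      proof -
        have "f 0 \<in> model_space \<Theta>" using f by auto
        then obtain x where "f 0 = u x" using bij by (auto simp: bij_betw_def)
        then have "f = U x" using f by (intro ext) (auto simp: U_def PiE_def extensional_def)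
        then show ?thesis by simp
      qed
      moreover have "U x \<in> {..<1} \<rightarrow>\<^sub>E model_space \<Theta>" for x
        using bij by (auto simp: U_def bij_betw_def)
      ultimately show "U ` vectors standard_space = vectors ?Y"
        by (auto simp: standard_space_def direct_sum_def ltwo_subspace_def)
    qed
  next
    show "\<forall>x\<in>vectors standard_space. \<forall>y\<in>vectors standard_space.
        U (vadd standard_space x y) = vadd ?Y (U x) (U y)"
      by (auto simp: U_def u_def standard_space_def direct_sum_def ltwo_subspace_def fun_eq_iff
          matrix_vector_right_distrib frame_map_add[OF pq])
    show "\<forall>a. \<forall>x\<in>vectors standard_space. U (vscale standard_space a x) = vscale ?Y a (U x)"
      by (auto simp: U_def u_def standard_space_def direct_sum_def ltwo_subspace_def fun_eq_iff
          vector_scalar_commute frame_map_scale[OF pq, symmetric])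
    show "\<forall>x\<in>vectors standard_space. \<forall>y\<in>vectors standard_space.
        vinner ?Y (U x) (U y) = vinner standard_space x y"
      by (simp add: U_def standard_space_def direct_sum_def ltwo_subspace_def inner)
  qed
  moreover have "map_option U (Some (M *v x)) =
      direct_sum_operator 1 (\<lambda>_. truncated_toeplitz \<Theta> (abs_ltwo c)) (U x)" for x
    by (auto simp: direct_sum_operator_def U_def toeplitz fun_eq_iff)
  ultimately have "unitarily_equivalent standard_space (\<lambda>x. Some (M *v x)) ?Y
      (direct_sum_operator 1 (\<lambda>_. truncated_toeplitz \<Theta> (abs_ltwo c)))"
    unfolding unitarily_equivalent_def by blast
  moreover have "inner_function \<Theta>" "\<not> \<Theta> constant_on ball 0 1"
    unfolding \<Theta>_def using inner_blaschke blaschke_not_constant parameter_bound[OF pq] by blast+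
  ultimately show ?thesis
    by (intro exI[of _ 1] exI[of _ "\<lambda>_. \<Theta>"] exI[of _ "\<lambda>_. abs_ltwo c"]) simp
qed

end
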